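(* Let $(R,\mathfrak m,k)$ be a commutative noetherian local ring of dimension $d>0$ for which $H^0_{\mathfrak m}(R)$ is a $k$-vector space, i.e. $\mathfrak m H^0_{\mathfrak m}(R)=0$ (for example, $R$ Buchsbaum). Let $M$ be a finitely generated $R$-module which is locally free on the punctured spectrum and such that $\operatorname{p.dim}_R(M)=\infty$. Then $\lambda(\operatorname{Syz}_i(M))=\infty$ for all $i>2$. If in addition $R$ is equidimensional, then $\dim(\operatorname{Syz}_i(M))=\dim R$ for all $i>2$.
   Context: $H^0_{\mathfrak m}(R)$ is the set of elements of $R$ annihilated by some power of $\mathfrak m$. $\operatorname{p.dim}$ denotes projective dimension and $\lambda(-)$ denotes length. A finitely generated module $M$ is locally free on the punctured spectrum if $M_{\mathfrak q}$ is free over $R_{\mathfrak q}$ for all $\mathfrak q\in\operatorname{Spec}(R)\setminus\{\mathfrak m\}$. $R$ is equidimensional if $\dim R/\mathfrak p=\dim R$ for every minimal prime $\mathfrak p$ of $R$. For a finitely generated module $M$ over a local ring $R$, let $\cdots\to R^{\beta_{i+1}}\xrightarrow{f_{i+1}}R^{\beta_i}\xrightarrow{f_i}\cdots\to R^{\beta_0}\xrightarrow{f_0}M\to 0$ be the minimal free resolution. For $i>0$, $\operatorname{Syz}_i(M):=\operatorname{coker}(f_{i+1})=\ker(f_{i-1})$ is the $i$-th syzygy module. A sequence $x_1,\dots,x_r$ in $\mathfrak m$ is a weak sequence if $\mathfrak m\,((x_1,\dots,x_{i-1}):x_i)\subseteq(x_1,\dots,x_{i-1})$ for all $i$. $R$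 is Buchsbaum if every system of parameters is a weak sequence. *)

theory Defs
  imports "HOL-Algebra.Module" "HOL-Algebra.Ideal_Product" "HOL-Algebra.Ring_Divisibility" "HOL-Library.Extended_Nat"
begin

section \<open>Rings\<close>

definition local_ring :: "('a, 'b) ring_scheme \<Rightarrow> 'a set \<Rightarrow> bool" where
  "local_ring R \<mm> \<longleftrightarrow> cring R \<and> maximalideal \<mm> R \<and> (\<forall>J. maximalideal J R \<longrightarrow> J = \<mm>)"

text \<open>The zero ring has no primes and gets dimension \<open>0\<close> here (instead of \<open>-\<infinity>\<close>).\<close>
definition krull_dim :: "('a, 'b) ring_scheme \<Rightarrow> enat" where
  "krull_dim R = Sup {enat n | n. \<exists>P :: nat \<Rightarrow> 'a set.
     (\<forall>i\<le>n. primeideal (P i) R) \<and> (\<forall>i<n. P i \<subset> P (Suc i))}"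

definition minimal_prime :: "('a, 'b) ring_scheme \<Rightarrow> 'a set \<Rightarrow> bool" where
  "minimal_prime R \<pp> \<longleftrightarrow> primeideal \<pp> R \<and> (\<forall>\<qq>. primeideal \<qq> R \<and> \<qq> \<subseteq> \<pp> \<longrightarrow> \<qq> = \<pp>)"

definition equidimensional :: "('a, 'b) ring_scheme \<Rightarrow> bool" where
  "equidimensional R \<longleftrightarrow> (\<forall>\<pp>. minimal_prime R \<pp> \<longrightarrow> krull_dim (R Quot \<pp>) = krull_dim R)"

text \<open>\<open>H\<^sup>0\<^sub>I(R)\<close>; the powers of \<open>I\<close> are formed in the monoid \<^const>\<open>ideals_set\<close> of ideals of \<open>R\<close>.\<close>
definition local_cohomology_0 :: "('a, 'b) ring_scheme \<Rightarrow> 'a set \<Rightarrow> 'a set" where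
  "local_cohomology_0 R I = {x \<in> carrier R. \<exists>n::nat.
     \<forall>a \<in> I [^]\<^bsub>ideals_set R\<^esub> n. a \<otimes>\<^bsub>R\<^esub> x = \<zero>\<^bsub>R\<^esub>}"


section \<open>Modules\<close>

definition mod_hom ::
    "('a, 'b) ring_scheme \<Rightarrow> ('a, 'm, 'c) module_scheme \<Rightarrow> ('a, 'n, 'd) module_scheme \<Rightarrow> ('m \<Rightarrow> 'n) set" where
  "mod_hom R M N = {f \<in> carrier M \<rightarrow> carrier N.
     (\<forall>x\<in>carrier M. \<forall>y\<in>carrier M. f (x \<oplus>\<^bsub>M\<^esub> y) = f x \<oplus>\<^bsub>N\<^esub> f y) \<and>
     (\<forall>a\<in>carrier R. \<forall>x\<in>carrier M. f (a \<odot>\<^bsub>M\<^esub> x) = a \<odot>\<^bsub>N\<^esub> f x)}"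

definition mod_ker :: "('a, 'm, 'c) module_scheme \<Rightarrow> ('a, 'n, 'd) module_scheme \<Rightarrow> ('m \<Rightarrow> 'n) \<Rightarrow> 'm set" where
  "mod_ker M N f = {x \<in> carrier M. f x = \<zero>\<^bsub>N\<^esub>}"

definition mod_isomorphic ::
    "('a, 'b) ring_scheme \<Rightarrow> ('a, 'm, 'c) module_scheme \<Rightarrow> ('a, 'n, 'd) module_scheme \<Rightarrow> bool" where
  "mod_isomorphic R M N \<longleftrightarrow> (\<exists>f \<in> mod_hom R M N. bij_betw f (carrier M) (carrier N))"

definition finitely_generated_module :: "('a, 'b) ring_scheme \<Rightarrow> ('a, 'm, 'c) module_scheme \<Rightarrow> bool" where
  "finitely_generated_module R M \<longleftrightarrow> (\<exists>A \<subseteq> carrier M. finite A \<and>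
     (\<forall>N. submodule N R M \<and> A \<subseteq> N \<longrightarrow> N = carrier M))"

definition module_length :: "('a, 'b) ring_scheme \<Rightarrow> ('a, 'm, 'c) module_scheme \<Rightarrow> enat" where
  "module_length R M = Sup {enat n | n. \<exists>N :: nat \<Rightarrow> 'm set.
     (\<forall>i\<le>n. submodule (N i) R M) \<and> (\<forall>i<n. N i \<subset> N (Suc i))}"

definition annihilator :: "('a, 'b) ring_scheme \<Rightarrow> ('a, 'm, 'c) module_scheme \<Rightarrow> 'a set" where
  "annihilator R M = {a \<in> carrier R. \<forall>x\<in>carrier M. a \<odot>\<^bsub>M\<^esub> x = \<zero>\<^bsub>M\<^esub>}"

definition module_dim :: "('a, 'b) ring_scheme \<Rightarrow> ('a, 'm, 'c) module_scheme \<Rightarrow> enat" where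
  "module_dim R M = krull_dim (R Quot (annihilator R M))"

text \<open>The free module \<open>R\<^bsup>(B)\<^esup>\<close> of finitely supported functions, extended by zero outside \<open>B\<close>.
  The record fields \<open>mult\<close> and \<open>one\<close> of a module carry no meaning.\<close>
definition free_mod :: "('a, 'b) ring_scheme \<Rightarrow> 'x set \<Rightarrow> ('a, 'x \<Rightarrow> 'a) module" where
  "free_mod R B =
    \<lparr>carrier = {v. finite {x. v x \<noteq> \<zero>\<^bsub>R\<^esub>} \<and> (\<forall>x. v x \<in> carrier R) \<and> (\<forall>x. x \<notin> B \<longrightarrow> v x = \<zero>\<^bsub>R\<^esub>)},
     monoid.mult = undefined, one = undefined,
     zero = (\<lambda>x. \<zero>\<^bsub>R\<^esub>), add = (\<lambda>v w x. v x \<oplus>\<^bsub>R\<^esub> w x), smult = (\<lambda>a v x. a \<otimes>\<^bsub>R\<^esub> v x)\<rparr>"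

text \<open>A basis of \<open>M\<close> is itself a subset of \<open>M\<close>, so the index set can be taken in the type of elements of \<open>M\<close>.\<close>
definition is_free_module :: "('a, 'b) ring_scheme \<Rightarrow> ('a, 'm, 'c) module_scheme \<Rightarrow> bool" where
  "is_free_module R M \<longleftrightarrow> (\<exists>B :: 'm set. mod_isomorphic R (free_mod R B) M)"


section \<open>Localization\<close>

text \<open>The fraction \<open>x/s\<close> is the set of all \<open>(y, t)\<close> with \<open>y \<in> M\<close>, \<open>t \<in> S\<close> and
  \<open>u(tx - sy) = 0\<close> for some \<open>u \<in> S\<close>.\<close>
definition loc_frac ::
    "('a, 'b) ring_scheme \<Rightarrow> 'a set \<Rightarrow> ('a, 'm, 'c) module_scheme \<Rightarrow> 'm \<Rightarrow> 'a \<Rightarrow> ('m \<times> 'a) set" where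
  "loc_frac R S M x s = {(y, t). y \<in> carrier M \<and> t \<in> S \<and>
     (\<exists>u\<in>S. u \<odot>\<^bsub>M\<^esub> (t \<odot>\<^bsub>M\<^esub> x) = u \<odot>\<^bsub>M\<^esub> (s \<odot>\<^bsub>M\<^esub> y))}"

definition loc_module ::
    "('a, 'b) ring_scheme \<Rightarrow> 'a set \<Rightarrow> ('a, 'm, 'c) module_scheme \<Rightarrow> (('a \<times> 'a) set, ('m \<times> 'a) set) module" where
  "loc_module R S M =
    \<lparr>carrier = {loc_frac R S M x s | x s. x \<in> carrier M \<and> s \<in> S},
     monoid.mult = undefined, one = undefined,
     zero = loc_frac R S M \<zero>\<^bsub>M\<^esub> \<one>\<^bsub>R\<^esub>,
     add = (\<lambda>A B. \<Union>(x, s)\<in>A. \<Union>(y, t)\<in>B. loc_frac R S M (t \<odot>\<^bsub>M\<^esub> x \<oplus>\<^bsub>M\<^esub> s \<odot>\<^bsub>M\<^esub> y) (s \<otimes>\<^bsub>R\<^esub> t)),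
     smult = (\<lambda>A B. \<Union>(a, s)\<in>A. \<Union>(x, t)\<in>B. loc_frac R S M (a \<odot>\<^bsub>M\<^esub> x) (s \<otimes>\<^bsub>R\<^esub> t))\<rparr>"

definition self_module :: "('a, 'b) ring_scheme \<Rightarrow> ('a, 'a) module" where
  "self_module R = \<lparr>carrier = carrier R, monoid.mult = monoid.mult R, one = one R,
     zero = zero R, add = add R, smult = monoid.mult R\<rparr>"

definition loc_ring :: "('a, 'b) ring_scheme \<Rightarrow> 'a set \<Rightarrow> ('a \<times> 'a) set ring" where
  "loc_ring R S = (let L = loc_module R S (self_module R) in
    \<lparr>carrier = carrier L, monoid.mult = smult L, one = loc_frac R S (self_module R) \<one>\<^bsub>R\<^esub> \<one>\<^bsub>R\<^esub>,
     zero = zero L, add = add L\<rparr>)"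

definition locally_free_on_punctured_spectrum ::
    "('a, 'b) ring_scheme \<Rightarrow> 'a set \<Rightarrow> ('a, 'm, 'c) module_scheme \<Rightarrow> bool" where
  "locally_free_on_punctured_spectrum R \<mm> M \<longleftrightarrow> (\<forall>\<qq>. primeideal \<qq> R \<and> \<qq> \<noteq> \<mm> \<longrightarrow>
     is_free_module (loc_ring R (carrier R - \<qq>)) (loc_module R (carrier R - \<qq>) M))"


section \<open>Resolutions\<close>

text \<open>The lifting property. For the test modules it suffices to use the types below: lifting the identity of
  \<open>P\<close> along the canonical surjection \<open>R\<^bsup>(P)\<^esup> \<rightarrow> P\<close> exhibits \<open>P\<close> as a direct summand of a free module,
  and hence yields the lifting property against modules over any type.\<close>
definition is_projective_module :: "('a, 'b) ring_scheme \<Rightarrow> ('a, 'p) module \<Rightarrow> bool" where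
  "is_projective_module R P \<longleftrightarrow> module R P \<and>
     (\<forall>(N :: ('a, 'p \<Rightarrow> 'a) module) (N' :: ('a, 'p) module). \<forall>g \<in> mod_hom R N N'. \<forall>h \<in> mod_hom R P N'.
        module R N \<and> module R N' \<and> g ` carrier N = carrier N' \<longrightarrow>
        (\<exists>h' \<in> mod_hom R P N. \<forall>x\<in>carrier P. g (h' x) = h x))"

text \<open>Exactness of \<open>\<dots> \<rightarrow> P\<^sub>2 \<rightarrow> P\<^sub>1 \<rightarrow> P\<^sub>0 \<rightarrow> M \<rightarrow> 0\<close> with \<open>f i : P\<^sub>i \<rightarrow> P\<^bsub>i-1\<^esub>\<close> for \<open>i > 0\<close> (\<open>f 0\<close> is not used).
  The augmentation \<open>\<epsilon> : P\<^sub>0 \<rightarrow> M\<close>, that is \<open>f\<^sub>0\<close>, is separate because its codomain has another type.\<close>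
definition is_resolution ::
    "('a, 'b) ring_scheme \<Rightarrow> ('a, 'm, 'c) module_scheme \<Rightarrow>
     (nat \<Rightarrow> ('a, 'p) module) \<Rightarrow> ('p \<Rightarrow> 'm) \<Rightarrow> (nat \<Rightarrow> 'p \<Rightarrow> 'p) \<Rightarrow> bool" where
  "is_resolution R M P \<epsilon> f \<longleftrightarrow>
     (\<forall>i. module R (P i)) \<and>
     \<epsilon> \<in> mod_hom R (P 0) M \<and> (\<forall>i>0. f i \<in> mod_hom R (P i) (P (i - 1))) \<and>
     \<epsilon> ` carrier (P 0) = carrier M \<and>
     f 1 ` carrier (P 1) = mod_ker (P 0) M \<epsilon> \<and>
     (\<forall>i>0. f (i + 1) ` carrier (P (i + 1)) = mod_ker (P i) (P (i - 1)) (f i))"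

text \<open>Projective dimension of a finitely generated module over a noetherian ring. The infimum of the empty set
  is \<open>\<infinity>\<close>. Resolutions by modules with elements in \<^typ>\<open>nat \<Rightarrow> 'a\<close> suffice: \<open>M\<close> has a resolution by
  modules \<open>R\<^sup>k\<close>, and if its projective dimension is at most \<open>n\<close>, the \<open>n\<close>-th syzygy there is finitely
  generated and projective, so isomorphic to a submodule of one of these.\<close>
definition proj_dim :: "('a, 'b) ring_scheme \<Rightarrow> ('a, 'm, 'c) module_scheme \<Rightarrow> enat" where
  "proj_dim R M = Inf {enat n | n. \<exists>(P :: nat \<Rightarrow> ('a, nat \<Rightarrow> 'a) module) \<epsilon> f.
     is_resolution R M P \<epsilon> f \<and> (\<forall>i. is_projective_module R (P i)) \<and>
     (\<forall>i>n. carrier (P i) = {\<zero>\<^bsub>P i\<^esub>})}"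

text \<open>Minimality: \<open>f i\<close> maps into \<open>\<mm> R\<^bsup>\<beta> (i - 1)\<^esup>\<close> for all \<open>i > 0\<close>.\<close>
definition minimal_free_resolution ::
    "('a, 'b) ring_scheme \<Rightarrow> 'a set \<Rightarrow> ('a, 'm, 'c) module_scheme \<Rightarrow>
     (nat \<Rightarrow> nat) \<Rightarrow> ((nat \<Rightarrow> 'a) \<Rightarrow> 'm) \<Rightarrow> (nat \<Rightarrow> (nat \<Rightarrow> 'a) \<Rightarrow> (nat \<Rightarrow> 'a)) \<Rightarrow> bool" where
  "minimal_free_resolution R \<mm> M \<beta> \<epsilon> f \<longleftrightarrow>
     is_resolution R M (\<lambda>i. free_mod R {..<\<beta> i}) \<epsilon> f \<and>
     (\<forall>i>0. \<forall>v \<in> carrier (free_mod R {..<\<beta> i}). \<forall>j. f i v j \<in> \<mm>)"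

text \<open>\<open>Syz\<^sub>i(M) = ker f\<^bsub>i-1\<^esub>\<close> for \<open>i > 0\<close>, as a submodule of \<open>R\<^bsup>\<beta> (i - 1)\<^esup>\<close>, where \<open>f\<^sub>0\<close> is \<open>\<epsilon>\<close>.\<close>
definition Syz ::
    "('a, 'b) ring_scheme \<Rightarrow> ('a, 'm, 'c) module_scheme \<Rightarrow>
     (nat \<Rightarrow> nat) \<Rightarrow> ((nat \<Rightarrow> 'a) \<Rightarrow> 'm) \<Rightarrow> (nat \<Rightarrow> (nat \<Rightarrow> 'a) \<Rightarrow> (nat \<Rightarrow> 'a)) \<Rightarrow> nat \<Rightarrow> ('a, nat \<Rightarrow> 'a) module" where
  "Syz R M \<beta> \<epsilon> f i = (free_mod R {..<\<beta> (i - 1)})\<lparr>carrier :=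
     (if i = 1 then mod_ker (free_mod R {..<\<beta> 0}) M \<epsilon>
      else mod_ker (free_mod R {..<\<beta> (i - 1)}) (free_mod R {..<\<beta> (i - 2)}) (f (i - 1)))\<rparr>"

end

theory Submission
  imports Defs
begin

text \<open>
Write \<open>F\<^sub>i = R\<^bsup>\<beta> i\<^esup>\<close>, fix \<open>i > 2\<close>, and put \<open>k = i - 1\<close> and \<open>N = Syz\<^sub>i(M) = ker f\<^sub>k = im f\<^bsub>k+1\<^esub>\<close>.

The key point is that \<open>N\<close> contains an element \<open>v\<close> that no power of some \<open>a\<close> in \<open>\<mm>\<close> kills
(\<open>higher_syzygy_not_torsion\<close>). By the hypothesis on \<open>H\<^sup>0\<^sub>\<mm>(R)\<close>, \<open>\<mm>\<close>-power torsion in a free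
module is killed by \<open>\<mm>\<close> itself (\<open>torsion_killed_by_ideal\<close>),
and a minimal map, having its entries in \<open>\<mm>\<close>, kills everything that \<open>\<mm>\<close> kills. If \<open>N\<close> were \<open>\<mm>\<close>-power torsion, applying this to
\<open>f\<^sub>k\<close> and to \<open>f\<^bsub>k-1\<^esub>\<close> would force \<open>f\<^sub>k\<close> to be injective, and the resolution could be cut off there. In a module of finite
length every element is \<open>\<mm>\<close>-power torsion (\<open>finite_length_torsion\<close>), so \<open>N\<close> has infinite length.

For the dimension, let \<open>y\<close> be a multiple of \<open>v\<close> whose annihilator is a prime \<open>q \<noteq> \<mm>\<close>
(\<open>exists_prime_annihilator_avoiding\<close>). As \<open>M\<close> is free at \<open>q\<close>, the resolution splits there; with denominators
cleared, there are \<open>s\<close> outside \<open>q\<close> and an endomorphism \<open>P\<close> of \<open>F\<^sub>k\<close> with image in \<open>N\<close> that is multiplication by \<open>s\<close> on \<open>N\<close>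
(\<open>localized_contraction\<close>). Some entry of \<open>P\<close> is outside \<open>q\<close>, since otherwise \<open>s y = P y = 0\<close>. The annihilator of \<open>N\<close>
kills this entry, so it lies in every prime below \<open>q\<close> (\<open>annihilator_subset_smaller_prime\<close>), in particular in a minimal
prime \<open>p\<close> of \<open>R\<close>. If \<open>R\<close> is equidimensional, then \<open>dim R = dim R/p \<le> dim N \<le> dim R\<close>.
\<close>

section \<open>Ideals and annihilators\<close>

lemma (in noetherian_ring) family_of_ideals_has_maximal:
  assumes "I \<in> F" "\<And>J. J \<in> F \<Longrightarrow> ideal J R"
  obtains J where "J \<in> F" "\<And>K. K \<in> F \<Longrightarrow> J \<subseteq> K \<Longrightarrow> K = J"
proof -
  have "\<exists>U\<in>F. \<forall>J\<in>C. J \<subseteq> U" if C: "subset.chain F C" for C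
  proof (cases "C = {}")
    case True
    then show ?thesis using assms(1) by blast
  next
    case False
    have "subset.chain {I. ideal I R} C"
      using C assms(2) unfolding pred_on.chain_def by blast
    then have "\<Union>C \<in> C" using ideal_chain_is_trivial False by blast
    then have "\<Union>C \<in> F" using C unfolding pred_on.chain_def by auto
    then show ?thesis by (rule rev_bexI) (simp add: Union_upper)
  qed
  from subset_Zorn[OF this] show ?thesis using that by blast
qed

lemma local_ringD:
  assumes "local_ring R \<mm>"
  shows "cring R" "maximalideal \<mm> R" "ideal \<mm> R"
  using assms
  by (auto simp: local_ring_def maximalideal_def)

lemma proper_ideal_subset_maximal:
  assumes R: "noetherian_ring R" "local_ring R \<mm>"
    and I: "ideal I R" "I \<noteq> carrier R"
  shows "I \<subseteq> \<mm>"
proof -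
  interpret noetherian_ring R by fact
  define F where "F = {J. ideal J R \<and> I \<subseteq> J \<and> J \<noteq> carrier R}"
  have IF: "I \<in> F" using I by (simp add: F_def)
  have "\<And>J. J \<in> F \<Longrightarrow> ideal J R" by (simp add: F_def)
  from family_of_ideals_has_maximal[OF IF this]
  obtain J where J: "J \<in> F" "\<And>K. K \<in> F \<Longrightarrow> J \<subseteq> K \<Longrightarrow> K = J" by blast
  have "maximalideal J R"
  proof (rule maximalidealI)
    show "ideal J R" "carrier R \<noteq> J" using J(1) by (auto simp: F_def)
    fix K assume K: "ideal K R" "J \<subseteq> K" "K \<subseteq> carrier R"
    show "K = J \<or> K = carrier R" using J(2)[of K] J(1) K by (auto simp: F_def)
  qed
  then show ?thesis using R(2) J(1) by (auto simp: local_ring_def F_def)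
qed

lemma local_ring_unit:
  assumes R: "noetherian_ring R" "local_ring R \<mm>"
    and u: "u \<in> carrier R" "u \<notin> \<mm>"
  obtains v where "v \<in> carrier R" "v \<otimes>\<^bsub>R\<^esub> u = \<one>\<^bsub>R\<^esub>"
proof -
  interpret cring R using local_ringD[OF R(2)] by blast
  have "PIdl\<^bsub>R\<^esub> u = carrier R"
    using proper_ideal_subset_maximal[OF R cgenideal_ideal[OF u(1)]] cgenideal_self[OF u(1)] u
    by blast
  then have "\<one>\<^bsub>R\<^esub> \<in> PIdl\<^bsub>R\<^esub> u" by simp
  then obtain v where "v \<in> carrier R" "\<one>\<^bsub>R\<^esub> = v \<otimes>\<^bsub>R\<^esub> u"
    unfolding cgenideal_def by blast
  then show ?thesis using that[of v] by metis
qed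

context module
begin

lemma ideal_quotient_is_ideal:
  assumes Q: "submodule Q R M" and y: "y \<in> carrier M"
  shows "ideal {b \<in> carrier R. b \<odot>\<^bsub>M\<^esub> y \<in> Q} R"
proof (rule idealI)
  show "ring R" by (rule R.ring_axioms)
  note E = submoduleE[OF Q]
  have z: "\<zero>\<^bsub>M\<^esub> \<in> Q" using Q by (metis subgroup.one_closed submodule.axioms(1) monoid.simps(2))
  show "subgroup {b \<in> carrier R. b \<odot>\<^bsub>M\<^esub> y \<in> Q} (add_monoid R)"
    using y z E(3,5) by (intro R.add.subgroupI) (auto simp: smult_l_distr smult_l_minus simp flip: a_inv_def)
  fix a x assume a: "a \<in> {b \<in> carrier R. b \<odot>\<^bsub>M\<^esub> y \<in> Q}" and x: "x \<in> carrier R"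
  show "x \<otimes> a \<in> {b \<in> carrier R. b \<odot>\<^bsub>M\<^esub> y \<in> Q}"
    using a x y E(4) by (auto simp: smult_assoc1)
  then show "a \<otimes> x \<in> {b \<in> carrier R. b \<odot>\<^bsub>M\<^esub> y \<in> Q}"
    using a x by (auto simp: R.m_comm)
qed

lemma smult_left_commute:
  assumes "a \<in> carrier R" "b \<in> carrier R" "x \<in> carrier M"
  shows "a \<odot>\<^bsub>M\<^esub> (b \<odot>\<^bsub>M\<^esub> x) = b \<odot>\<^bsub>M\<^esub> (a \<odot>\<^bsub>M\<^esub> x)"
  using assms by (metis smult_assoc1 R.m_comm)

lemma zero_submodule: "submodule {\<zero>\<^bsub>M\<^esub>} R M"
  by (rule submoduleI) auto

lemma annihilator_of_element_is_ideal:
  assumes "y \<in> carrier M"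
  shows "ideal {b \<in> carrier R. b \<odot>\<^bsub>M\<^esub> y = \<zero>\<^bsub>M\<^esub>} R"
  using ideal_quotient_is_ideal[OF zero_submodule assms] by simp

lemma annihilator_is_ideal: "ideal (annihilator R M) R"
proof (rule idealI)
  show "ring R" by (rule R.ring_axioms)
  show "subgroup (annihilator R M) (add_monoid R)"
    by (intro R.add.subgroupI) (auto simp: annihilator_def smult_l_distr smult_l_minus simp flip: a_inv_def)
qed (auto simp: annihilator_def smult_assoc1)

lemma elements_killed_by_ideal_submodule:
  assumes "I \<subseteq> carrier R"
  shows "submodule {x \<in> carrier M. \<forall>a\<in>I. a \<odot>\<^bsub>M\<^esub> x = \<zero>\<^bsub>M\<^esub>} R M"
  using assms
  by (intro submoduleI) (auto simp: smult_r_minus smult_r_distr smult_left_commute subset_iff)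

text \<open>The hypothesis compares only the first two powers of the ideal \<open>I\<close>, yet it controls all \<open>I\<close>-torsion. Let \<open>Q\<close> be the
submodule of elements killed by \<open>I\<close>. If \<open>x\<close> were not in \<open>Q\<close>, choose a multiple \<open>r x\<close> outside \<open>Q\<close> whose ideal
quotient \<open>(Q : r x)\<close> is maximal. For \<open>b\<close> in \<open>I\<close>, replacing \<open>r x\<close> by the last \<open>b\<^sup>l r x\<close> outside \<open>Q\<close> cannot enlarge
this ideal, so it already contains \<open>b\<close>. Hence \<open>I r x \<subseteq> Q\<close>, that is \<open>I\<^sup>2 r x = 0\<close>, and the hypothesis puts
\<open>r x\<close> into \<open>Q\<close>.\<close>

lemma torsion_killed_by_ideal:
  assumes R: "noetherian_ring R" and I: "ideal I R"
    and sq: "\<And>x. x \<in> carrier M \<Longrightarrow> \<forall>a\<in>I. \<forall>b\<in>I. a \<odot>\<^bsub>M\<^esub> (b \<odot>\<^bsub>M\<^esub> x) = \<zero>\<^bsub>M\<^esub>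
              \<Longrightarrow> \<forall>a\<in>I. a \<odot>\<^bsub>M\<^esub> x = \<zero>\<^bsub>M\<^esub>"
    and x: "x \<in> carrier M" "\<And>a. a \<in> I \<Longrightarrow> \<exists>n::nat. (a [^] n) \<odot>\<^bsub>M\<^esub> x = \<zero>\<^bsub>M\<^esub>"
    and a: "a \<in> I"
  shows "a \<odot>\<^bsub>M\<^esub> x = \<zero>\<^bsub>M\<^esub>"
proof (rule ccontr)
  assume ax: "a \<odot>\<^bsub>M\<^esub> x \<noteq> \<zero>\<^bsub>M\<^esub>"
  have Isub: "I \<subseteq> carrier R" using I by (meson additive_subgroup.a_subset ideal.axioms(1))
  define Q where "Q = {x \<in> carrier M. \<forall>a\<in>I. a \<odot>\<^bsub>M\<^esub> x = \<zero>\<^bsub>M\<^esub>}"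
  have Q: "submodule Q R M" unfolding Q_def by (rule elements_killed_by_ideal_submodule[OF Isub])
  define J where "J r = {b \<in> carrier R. b \<odot>\<^bsub>M\<^esub> (r \<odot>\<^bsub>M\<^esub> x) \<in> Q}" for r
  define F where "F = {J r | r. r \<in> carrier R \<and> r \<odot>\<^bsub>M\<^esub> x \<notin> Q}"
  have "\<one> \<odot>\<^bsub>M\<^esub> x \<notin> Q" using ax a x(1) by (auto simp: Q_def)
  then have "J \<one> \<in> F" unfolding F_def by blast
  moreover have "ideal K R" if "K \<in> F" for K
    using that ideal_quotient_is_ideal[OF Q] x(1) by (auto simp: F_def J_def)
  ultimately obtain K where K: "K \<in> F" "\<And>L. L \<in> F \<Longrightarrow> K \<subseteq> L \<Longrightarrow> L = K"
    using noetherian_ring.family_of_ideals_has_maximal[OF R] by metis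
  then obtain r where r: "r \<in> carrier R" "r \<odot>\<^bsub>M\<^esub> x \<notin> Q" "K = J r" by (auto simp: F_def)
  have rx: "r \<odot>\<^bsub>M\<^esub> x \<in> carrier M" using r x by simp
  have "b \<in> J r" if b: "b \<in> I" for b
  proof -
    have bR: "b \<in> carrier R" using b Isub by blast
    obtain n :: nat where n: "(b [^] n) \<odot>\<^bsub>M\<^esub> x = \<zero>\<^bsub>M\<^esub>" using x(2)[OF b] by blast
    have zQ: "\<zero>\<^bsub>M\<^esub> \<in> Q" using Isub by (auto simp: Q_def)
    have ex: "(b [^] n) \<odot>\<^bsub>M\<^esub> (r \<odot>\<^bsub>M\<^esub> x) \<in> Q"
      using n zQ smult_left_commute[of "b [^] n" r x] bR r x by simp
    define k where "k = (LEAST n::nat. (b [^] n) \<odot>\<^bsub>M\<^esub> (r \<odot>\<^bsub>M\<^esub> x) \<in> Q)"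
    have k: "(b [^] k) \<odot>\<^bsub>M\<^esub> (r \<odot>\<^bsub>M\<^esub> x) \<in> Q" 
    unfolding k_def using ex by (rule LeastI[of "\<lambda>n. (b [^] n) \<odot>\<^bsub>M\<^esub> (r \<odot>\<^bsub>M\<^esub> x) \<in> Q"])
    have "k \<noteq> 0" using k r rx by (auto intro: ccontr)
    \<comment> \<open>\<open>b\<^sup>l\<close> is the last power of \<open>b\<close> that leaves \<open>r x\<close> outside \<open>Q\<close>\<close>
    then obtain l where l: "k = Suc l" by (cases k) auto
    have notQ: "(b [^] l) \<odot>\<^bsub>M\<^esub> (r \<odot>\<^bsub>M\<^esub> x) \<notin> Q"
      using not_less_Least[of l "\<lambda>n. (b [^] n) \<odot>\<^bsub>M\<^esub> (r \<odot>\<^bsub>M\<^esub> x) \<in> Q"] l k_def by simp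
    have eq: "(b [^] l \<otimes> r) \<odot>\<^bsub>M\<^esub> x = (b [^] l) \<odot>\<^bsub>M\<^esub> (r \<odot>\<^bsub>M\<^esub> x)"
      using bR r x by (simp add: smult_assoc1)
    have "J (b [^] l \<otimes> r) \<in> F" unfolding F_def using notQ eq r bR by auto
    moreover have "J r \<subseteq> J (b [^] l \<otimes> r)"
    proof
      fix c assume "c \<in> J r"
      then have c: "c \<in> carrier R" "c \<odot>\<^bsub>M\<^esub> (r \<odot>\<^bsub>M\<^esub> x) \<in> Q" by (auto simp: J_def)
      have "c \<odot>\<^bsub>M\<^esub> ((b [^] l) \<odot>\<^bsub>M\<^esub> (r \<odot>\<^bsub>M\<^esub> x)) = (b [^] l) \<odot>\<^bsub>M\<^esub> (c \<odot>\<^bsub>M\<^esub> (r \<odot>\<^bsub>M\<^esub> x))"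
        using c bR rx by (intro smult_left_commute) auto
      then show "c \<in> J (b [^] l \<otimes> r)"
        unfolding J_def eq using submodule.smult_closed[OF Q, of "b [^] l"] c bR by simp
    qed
    ultimately have "J (b [^] l \<otimes> r) = J r" using K(2) r(3) by blast
    moreover have "b \<in> J (b [^] l \<otimes> r)"
      unfolding J_def eq using k l bR rx smult_assoc1[of b "b [^] l" "r \<odot>\<^bsub>M\<^esub> x"] by (simp add: R.m_comm)
    ultimately show ?thesis by simp
  qed
  then have "\<forall>a\<in>I. \<forall>b\<in>I. a \<odot>\<^bsub>M\<^esub> (b \<odot>\<^bsub>M\<^esub> (r \<odot>\<^bsub>M\<^esub> x)) = \<zero>\<^bsub>M\<^esub>"
    by (auto simp: J_def Q_def)
  then have "r \<odot>\<^bsub>M\<^esub> x \<in> Q" using sq[OF rx] rx by (simp add: Q_def)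
  then show False using r by blast
qed

text \<open>This is the existence of associated primes, but the maximal annihilator is taken only among the multiples of \<open>x\<close> that
are not \<open>a\<close>-power torsion; this is what keeps \<open>a\<close> out of the prime. If \<open>y\<close> is such a maximal choice and \<open>c y \<noteq> 0\<close>,
then \<open>c y\<close> is again not \<open>a\<close>-power torsion, because \<open>a\<^sup>n y\<close> has the same annihilator as \<open>y\<close>; so, by
maximality, \<open>c y\<close> has the same annihilator as \<open>y\<close>, and \<open>b c y = 0\<close> implies \<open>b y = 0\<close>.\<close>

lemma exists_prime_annihilator_avoiding:
  assumes R: "noetherian_ring R"
    and x: "x \<in> carrier M" and a: "a \<in> carrier R" "\<And>n::nat. (a [^] n) \<odot>\<^bsub>M\<^esub> x \<noteq> \<zero>\<^bsub>M\<^esub>"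
  obtains r where "r \<in> carrier R" "primeideal {b \<in> carrier R. b \<odot>\<^bsub>M\<^esub> (r \<odot>\<^bsub>M\<^esub> x) = \<zero>\<^bsub>M\<^esub>} R"
    "a \<odot>\<^bsub>M\<^esub> (r \<odot>\<^bsub>M\<^esub> x) \<noteq> \<zero>\<^bsub>M\<^esub>"
proof -
  define J where "J y = {b \<in> carrier R. b \<odot>\<^bsub>M\<^esub> y = \<zero>\<^bsub>M\<^esub>}" for y
  define G where "G = {r \<in> carrier R. \<forall>n::nat. (a [^] n) \<odot>\<^bsub>M\<^esub> (r \<odot>\<^bsub>M\<^esub> x) \<noteq> \<zero>\<^bsub>M\<^esub>}"
  define F where "F = (\<lambda>r. J (r \<odot>\<^bsub>M\<^esub> x)) ` G"
  have "\<one> \<in> G" using x a by (simp add: G_def)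
  then have "J (\<one> \<odot>\<^bsub>M\<^esub> x) \<in> F" unfolding F_def by blast
  moreover have "ideal K R" if "K \<in> F" for K
    using that annihilator_of_element_is_ideal x by (auto simp: F_def J_def G_def)
  ultimately obtain K where K: "K \<in> F" "\<And>L. L \<in> F \<Longrightarrow> K \<subseteq> L \<Longrightarrow> L = K"
    using noetherian_ring.family_of_ideals_has_maximal[OF R] by metis
  then obtain r where r: "r \<in> G" "K = J (r \<odot>\<^bsub>M\<^esub> x)" by (auto simp: F_def)
  have rR: "r \<in> carrier R" using r by (simp add: G_def)
  define y where "y = r \<odot>\<^bsub>M\<^esub> x"
  have y: "y \<in> carrier M" using rR x by (simp add: y_def)
  have ay: "(a [^] n) \<odot>\<^bsub>M\<^esub> y \<noteq> \<zero>\<^bsub>M\<^esub>" for n :: nat using r by (simp add: G_def y_def)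
  have J_le: "J y \<subseteq> J (c \<odot>\<^bsub>M\<^esub> y)" if "c \<in> carrier R" for c
    using that y by (auto simp: J_def smult_left_commute[of _ c y])
  have J_eq: "J (c \<odot>\<^bsub>M\<^esub> y) = J y"
    if c: "c \<in> carrier R" "\<And>n::nat. (a [^] n) \<odot>\<^bsub>M\<^esub> (c \<odot>\<^bsub>M\<^esub> y) \<noteq> \<zero>\<^bsub>M\<^esub>" for c
  proof -
    have eq: "(c \<otimes> r) \<odot>\<^bsub>M\<^esub> x = c \<odot>\<^bsub>M\<^esub> y" using c rR x by (simp add: y_def smult_assoc1)
    then have "c \<otimes> r \<in> G" using c rR by (simp add: G_def)
    then have "J (c \<odot>\<^bsub>M\<^esub> y) \<in> F" unfolding F_def using eq by (metis imageI)
    then show ?thesis using K(2) J_le[OF c(1)] r(2) by (simp add: y_def)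
  qed
  have pow: "J ((a [^] n) \<odot>\<^bsub>M\<^esub> y) = J y" for n :: nat
  proof (rule J_eq)
    show "(a [^] k) \<odot>\<^bsub>M\<^esub> ((a [^] n) \<odot>\<^bsub>M\<^esub> y) \<noteq> \<zero>\<^bsub>M\<^esub>" for k :: nat
      using ay[of "k + n"] a y by (simp add: smult_assoc1[symmetric] R.nat_pow_mult)
  qed (use a in simp)
  have "primeideal (J y) R"
  proof (rule primeidealI)
    show "ideal (J y) R" unfolding J_def by (rule annihilator_of_element_is_ideal[OF y])
    show "cring R" by (rule R.cring_axioms)
    have "\<one> \<notin> J y" using ay[of 0] y by (simp add: J_def)
    then show "carrier R \<noteq> J y" by blast
    fix b c assume b: "b \<in> carrier R" and c: "c \<in> carrier R" and bc: "b \<otimes> c \<in> J y"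
    have "b \<in> J y" if cn: "c \<notin> J y"
    proof -
      have "(a [^] n) \<odot>\<^bsub>M\<^esub> (c \<odot>\<^bsub>M\<^esub> y) \<noteq> \<zero>\<^bsub>M\<^esub>" for n :: nat
        using cn pow[of n] a c y by (auto simp: J_def smult_left_commute[of "a [^] n" c y])
      then have "J (c \<odot>\<^bsub>M\<^esub> y) = J y" by (rule J_eq[OF c])
      moreover have "b \<in> J (c \<odot>\<^bsub>M\<^esub> y)" using bc b c y by (simp add: J_def smult_assoc1)
      ultimately show ?thesis by simp
    qed
    then show "b \<in> J y \<or> c \<in> J y" by blast
  qed
  moreover have "a \<odot>\<^bsub>M\<^esub> y \<noteq> \<zero>\<^bsub>M\<^esub>" using ay[of 1] a by simp
  ultimately show ?thesis using that rR unfolding J_def y_def by blast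
qed

end

section \<open>Homomorphisms out of free modules\<close>

lemma mod_homD:
  assumes "f \<in> mod_hom R M N"
  shows "x \<in> carrier M \<Longrightarrow> f x \<in> carrier N"
    "x \<in> carrier M \<Longrightarrow> y \<in> carrier M \<Longrightarrow> f (x \<oplus>\<^bsub>M\<^esub> y) = f x \<oplus>\<^bsub>N\<^esub> f y"
    "a \<in> carrier R \<Longrightarrow> x \<in> carrier M \<Longrightarrow> f (a \<odot>\<^bsub>M\<^esub> x) = a \<odot>\<^bsub>N\<^esub> f x"
  using assms by (auto simp: mod_hom_def)

lemma mod_homI:
  assumes "\<And>x. x \<in> carrier M \<Longrightarrow> f x \<in> carrier N"
    "\<And>x y. x \<in> carrier M \<Longrightarrow> y \<in> carrier M \<Longrightarrow> f (x \<oplus>\<^bsub>M\<^esub> y) = f x \<oplus>\<^bsub>N\<^esub> f y"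
    "\<And>a x. a \<in> carrier R \<Longrightarrow> x \<in> carrier M \<Longrightarrow> f (a \<odot>\<^bsub>M\<^esub> x) = a \<odot>\<^bsub>N\<^esub> f x"
  shows "f \<in> mod_hom R M N"
  using assms by (auto simp: mod_hom_def)

lemma mod_hom_zero:
  assumes "f \<in> mod_hom R M N" "module R M" "module R N"
  shows "f \<zero>\<^bsub>M\<^esub> = \<zero>\<^bsub>N\<^esub>"
proof -
  interpret M: module R M by fact
  interpret N: module R N by fact
  have "f (\<zero>\<^bsub>R\<^esub> \<odot>\<^bsub>M\<^esub> \<zero>\<^bsub>M\<^esub>) = \<zero>\<^bsub>R\<^esub> \<odot>\<^bsub>N\<^esub> f \<zero>\<^bsub>M\<^esub>"
    by (rule mod_homD[OF assms(1)]) auto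
  then show ?thesis using mod_homD(1)[OF assms(1), of "\<zero>\<^bsub>M\<^esub>"] by simp
qed

lemma mod_hom_diff:
  assumes f: "f \<in> mod_hom R M N" and M: "module R M" and N: "module R N"
    and x: "x \<in> carrier M" and y: "y \<in> carrier M"
  shows "f (x \<ominus>\<^bsub>M\<^esub> y) = f x \<ominus>\<^bsub>N\<^esub> f y"
proof -
  interpret M: module R M by fact
  interpret N: module R N by fact
  have "f (\<ominus>\<^bsub>M\<^esub> y) = f ((\<ominus>\<^bsub>R\<^esub> \<one>\<^bsub>R\<^esub>) \<odot>\<^bsub>M\<^esub> y)" using y by (simp add: M.smult_l_minus)
  also have "\<dots> = (\<ominus>\<^bsub>R\<^esub> \<one>\<^bsub>R\<^esub>) \<odot>\<^bsub>N\<^esub> f y" using y by (intro mod_homD[OF f]) auto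
  also have "\<dots> = \<ominus>\<^bsub>N\<^esub> f y" using mod_homD(1)[OF f y] by (simp add: N.smult_l_minus)
  finally show ?thesis using mod_homD(2)[OF f x, of "\<ominus>\<^bsub>M\<^esub> y"] y
    by (simp add: a_minus_def)
qed

lemma mod_hom_comp:
  assumes "f \<in> mod_hom R M N" "g \<in> mod_hom R N P"
  shows "(\<lambda>x. g (f x)) \<in> mod_hom R M P"
  using assms by (auto simp: mod_hom_def Pi_iff)

lemma mod_hom_smult:
  assumes f: "f \<in> mod_hom R M N" and N: "module R N" and s: "s \<in> carrier R"
  shows "(\<lambda>x. s \<odot>\<^bsub>N\<^esub> f x) \<in> mod_hom R M N"
proof -
  interpret N: module R N by fact
  show ?thesis
    by (rule mod_homI) (use s in \<open>simp_all add: mod_homD[OF f] N.smult_r_distr N.smult_left_commute\<close>)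
qed

lemma mod_hom_minus:
  assumes f: "f \<in> mod_hom R M N" and g: "g \<in> mod_hom R M N" and N: "module R N"
  shows "(\<lambda>x. f x \<ominus>\<^bsub>N\<^esub> g x) \<in> mod_hom R M N"
proof -
  interpret N: module R N by fact
  show ?thesis
    by (rule mod_homI)
      (auto simp: mod_homD[OF f] mod_homD[OF g] N.smult_r_distr N.smult_r_minus
        a_minus_def N.minus_add N.a_ac)
qed

lemma mod_hom_id: "(\<lambda>x. x) \<in> mod_hom R M M"
  by (simp add: mod_hom_def)

lemma mod_ker_submodule:
  assumes M: "module R M" and N: "module R N" and f: "f \<in> mod_hom R M N"
  shows "submodule (mod_ker M N f) R M"
proof -
  interpret M: module R M by fact
  interpret N: module R N by fact
  show ?thesis
  proof (rule M.submoduleI)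
    fix a assume "a \<in> mod_ker M N f"
    then have a: "a \<in> carrier M" "f a = \<zero>\<^bsub>N\<^esub>" by (auto simp: mod_ker_def)
    have "\<ominus>\<^bsub>M\<^esub> a = \<zero>\<^bsub>M\<^esub> \<ominus>\<^bsub>M\<^esub> a" using a by (simp add: a_minus_def)
    then show "\<ominus>\<^bsub>M\<^esub> a \<in> mod_ker M N f"
      using mod_hom_diff[OF f M N M.zero_closed a(1)] a mod_hom_zero[OF f M N]
      by (simp add: mod_ker_def a_minus_def)
  qed (auto simp: mod_ker_def mod_hom_zero[OF f M N] mod_homD[OF f])
qed

definition unit_vec :: "('a, 'b) ring_scheme \<Rightarrow> 'x \<Rightarrow> 'x \<Rightarrow> 'a" where
  "unit_vec R b = (\<lambda>x. if x = b then \<one>\<^bsub>R\<^esub> else \<zero>\<^bsub>R\<^esub>)"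

context cring
begin

lemma free_mod_carrier:
  "v \<in> carrier (free_mod R B) \<longleftrightarrow> finite {x. v x \<noteq> \<zero>} \<and> (\<forall>x. v x \<in> carrier R) \<and> (\<forall>x. x \<notin> B \<longrightarrow> v x = \<zero>)"
  by (simp add: free_mod_def)

lemma free_mod_carrier_finite:
  "finite B \<Longrightarrow> v \<in> carrier (free_mod R B) \<longleftrightarrow> (\<forall>x. v x \<in> carrier R) \<and> (\<forall>x. x \<notin> B \<longrightarrow> v x = \<zero>)"
  unfolding free_mod_carrier by (auto intro: finite_subset[of _ B])

lemma free_mod_simps:
  "\<zero>\<^bsub>free_mod R B\<^esub> = (\<lambda>x. \<zero>)"
  "v \<oplus>\<^bsub>free_mod R B\<^esub> w = (\<lambda>x. v x \<oplus> w x)"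
  "a \<odot>\<^bsub>free_mod R B\<^esub> v = (\<lambda>x. a \<otimes> v x)"
  by (simp_all add: free_mod_def)

lemma free_mod_zero_closed: "(\<lambda>x. \<zero>) \<in> carrier (free_mod R B)"
  by (simp add: free_mod_carrier)

lemma free_mod_add_closed:
  assumes "v \<in> carrier (free_mod R B)" "w \<in> carrier (free_mod R B)"
  shows "(\<lambda>x. v x \<oplus> w x) \<in> carrier (free_mod R B)"
proof -
  have "{x. v x \<oplus> w x \<noteq> \<zero>} \<subseteq> {x. v x \<noteq> \<zero>} \<union> {x. w x \<noteq> \<zero>}" by auto
  then show ?thesis using assms by (auto simp: free_mod_carrier intro: finite_subset)
qed

lemma free_mod_smult_closed:
  assumes "a \<in> carrier R" "v \<in> carrier (free_mod R B)"
  shows "(\<lambda>x. a \<otimes> v x) \<in> carrier (free_mod R B)"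
proof -
  have "{x. a \<otimes> v x \<noteq> \<zero>} \<subseteq> {x. v x \<noteq> \<zero>}" using assms by auto
  then show ?thesis using assms by (auto simp: free_mod_carrier intro: finite_subset)
qed

lemma free_mod_module: "module R (free_mod R B)"
proof (rule moduleI)
  show "cring R" by (rule cring_axioms)
  show "abelian_group (free_mod R B)"
  proof (rule abelian_groupI)
    fix x assume x: "x \<in> carrier (free_mod R B)"
    show "\<exists>y\<in>carrier (free_mod R B). y \<oplus>\<^bsub>free_mod R B\<^esub> x = \<zero>\<^bsub>free_mod R B\<^esub>"
    proof
      show "(\<lambda>i. \<ominus> \<one> \<otimes> x i) \<in> carrier (free_mod R B)"
        using x by (intro free_mod_smult_closed) auto
      show "(\<lambda>i. \<ominus> \<one> \<otimes> x i) \<oplus>\<^bsub>free_mod R B\<^esub> x = \<zero>\<^bsub>free_mod R B\<^esub>"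
        using x by (auto simp: free_mod_simps free_mod_carrier l_minus l_neg)
    qed
  qed (auto simp: free_mod_simps free_mod_zero_closed free_mod_add_closed,
      auto simp: free_mod_carrier a_ac)
qed (auto simp: free_mod_simps free_mod_add_closed free_mod_smult_closed,
     auto simp: free_mod_carrier l_distr r_distr m_assoc)

lemma unit_vec_closed: "b \<in> B \<Longrightarrow> unit_vec R b \<in> carrier (free_mod R B)"
  by (auto simp: free_mod_carrier unit_vec_def)

end

lemma free_mod_hom_expand:
  assumes N: "module R N" and h: "h \<in> mod_hom R (free_mod R B) N"
    and A: "finite A" "A \<subseteq> B" and v: "v \<in> carrier (free_mod R B)" "\<And>x. x \<notin> A \<Longrightarrow> v x = \<zero>\<^bsub>R\<^esub>"
  shows "h v = (\<Oplus>\<^bsub>N\<^esub>b\<in>A. v b \<odot>\<^bsub>N\<^esub> h (unit_vec R b))"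
  using A v
proof (induction A arbitrary: v rule: finite_induct)
  case empty
  interpret N: module R N by fact
  have "v = \<zero>\<^bsub>free_mod R B\<^esub>" using empty by (auto simp: N.free_mod_simps)
  then show ?case using mod_hom_zero[OF h N.free_mod_module N] by simp
next
  case (insert b A)
  interpret N: module R N by fact
  note v = insert.prems(2,3)
  define w where "w = (\<lambda>x. if x = b then \<zero>\<^bsub>R\<^esub> else v x)"
  have vR: "v x \<in> carrier R" for x using v by (simp add: N.free_mod_carrier)
  have w: "w \<in> carrier (free_mod R B)"
    using v insert.hyps(1) insert.prems(1) vR
    by (auto simp: N.free_mod_carrier w_def intro: finite_subset[of _ A])
  have eb: "unit_vec R x \<in> carrier (free_mod R B)" if "x \<in> insert b A" for x
    using that insert.prems(1) by (auto intro: N.unit_vec_closed)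
  let ?e = "v b \<odot>\<^bsub>free_mod R B\<^esub> unit_vec R b"
  have e: "?e \<in> carrier (free_mod R B)"
    using N.free_mod_smult_closed[OF vR eb] by (simp add: N.free_mod_simps)
  have "v = ?e \<oplus>\<^bsub>free_mod R B\<^esub> w"
    using vR by (auto simp: N.free_mod_simps unit_vec_def w_def)
  then have "h v = h ?e \<oplus>\<^bsub>N\<^esub> h w"
    using mod_homD(2)[OF h e w] by simp
  also have "h ?e = v b \<odot>\<^bsub>N\<^esub> h (unit_vec R b)"
    using mod_homD(3)[OF h vR eb] by simp
  also have "h w = (\<Oplus>\<^bsub>N\<^esub>x\<in>A. w x \<odot>\<^bsub>N\<^esub> h (unit_vec R x))"
    using insert.IH[OF _ w] insert.prems(1) v(2) by (auto simp: w_def)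
  also have "\<dots> = (\<Oplus>\<^bsub>N\<^esub>x\<in>A. v x \<odot>\<^bsub>N\<^esub> h (unit_vec R x))"
    using eb mod_homD(1)[OF h] vR insert.hyps(2)
    by (intro N.finsum_cong') (auto simp: w_def)
  finally show ?case
    using insert.hyps eb mod_homD(1)[OF h] vR by (simp add: N.finsum_insert Pi_iff)
qed

lemma free_mod_hom_expand_finite:
  assumes N: "module R N" and B: "finite B" and h: "h \<in> mod_hom R (free_mod R B) N"
    and v: "v \<in> carrier (free_mod R B)"
  shows "h v = (\<Oplus>\<^bsub>N\<^esub>b\<in>B. v b \<odot>\<^bsub>N\<^esub> h (unit_vec R b))"
proof (rule free_mod_hom_expand[OF N h B order_refl v])
  interpret N: module R N by fact
  show "x \<notin> B \<Longrightarrow> v x = \<zero>\<^bsub>R\<^esub>" for x using v by (simp add: N.free_mod_carrier)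
qed

lemma free_mod_hom_eqI:
  assumes N: "module R N" and B: "finite B"
    and h: "h \<in> mod_hom R (free_mod R B) N" "g \<in> mod_hom R (free_mod R B) N"
    and eq: "\<And>b. b \<in> B \<Longrightarrow> h (unit_vec R b) = g (unit_vec R b)"
    and v: "v \<in> carrier (free_mod R B)"
  shows "h v = g v"
proof -
  interpret N: module R N by fact
  have *: "\<And>x. v x \<in> carrier R" using v by (auto simp: N.free_mod_carrier)
  show ?thesis
    unfolding free_mod_hom_expand_finite[OF N B h(1) v] free_mod_hom_expand_finite[OF N B h(2) v]
    using eq mod_homD(1)[OF h(2)] N.unit_vec_closed[of _ B] * by (intro N.finsum_cong') auto
qed

lemma free_mod_hom_zeroI:
  assumes N: "module R N" and B: "finite B" and h: "h \<in> mod_hom R (free_mod R B) N"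
    and v: "v \<in> carrier (free_mod R B)"
    and z: "\<And>b. b \<in> B \<Longrightarrow> v b \<odot>\<^bsub>N\<^esub> h (unit_vec R b) = \<zero>\<^bsub>N\<^esub>"
  shows "h v = \<zero>\<^bsub>N\<^esub>"
proof -
  interpret N: module R N by fact
  have "(\<Oplus>\<^bsub>N\<^esub>b\<in>B. v b \<odot>\<^bsub>N\<^esub> h (unit_vec R b)) = (\<Oplus>\<^bsub>N\<^esub>b\<in>B. \<zero>\<^bsub>N\<^esub>)"
    using z by (intro N.finsum_cong') auto
  then show ?thesis unfolding free_mod_hom_expand_finite[OF N B h v] by simp
qed

lemma free_mod_hom_exists:
  assumes N: "module R N" and B: "finite B" and g: "\<And>b. b \<in> B \<Longrightarrow> g b \<in> carrier N"
  obtains h where "h \<in> mod_hom R (free_mod R B) N" "\<And>b. b \<in> B \<Longrightarrow> h (unit_vec R b) = g b"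
proof -
  interpret N: module R N by fact
  define h where "h v = (\<Oplus>\<^bsub>N\<^esub>b\<in>B. v b \<odot>\<^bsub>N\<^esub> g b)" for v
  have c: "(\<lambda>b. v b \<odot>\<^bsub>N\<^esub> g b) \<in> B \<rightarrow> carrier N" if "v \<in> carrier (free_mod R B)" for v
    using that g by (auto simp: N.free_mod_carrier)
  have "h \<in> mod_hom R (free_mod R B) N"
  proof (rule mod_homI)
    show "h v \<in> carrier N" if "v \<in> carrier (free_mod R B)" for v
      unfolding h_def using c[OF that] by (rule N.finsum_closed)
    show "h (v \<oplus>\<^bsub>free_mod R B\<^esub> w) = h v \<oplus>\<^bsub>N\<^esub> h w"
      if "v \<in> carrier (free_mod R B)" "w \<in> carrier (free_mod R B)" for v w
    proof -
      have "h (v \<oplus>\<^bsub>free_mod R B\<^esub> w) = (\<Oplus>\<^bsub>N\<^esub>b\<in>B. v b \<odot>\<^bsub>N\<^esub> g b \<oplus>\<^bsub>N\<^esub> w b \<odot>\<^bsub>N\<^esub> g b)"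
        unfolding h_def N.free_mod_simps using that g
        by (intro N.finsum_cong') (auto simp: N.free_mod_carrier N.smult_l_distr)
      then show ?thesis unfolding h_def using N.finsum_addf[OF c c] that by simp
    qed
    show "h (a \<odot>\<^bsub>free_mod R B\<^esub> v) = a \<odot>\<^bsub>N\<^esub> h v"
      if "a \<in> carrier R" "v \<in> carrier (free_mod R B)" for a v
    proof -
      have "h (a \<odot>\<^bsub>free_mod R B\<^esub> v) = (\<Oplus>\<^bsub>N\<^esub>b\<in>B. a \<odot>\<^bsub>N\<^esub> (v b \<odot>\<^bsub>N\<^esub> g b))"
        unfolding h_def N.free_mod_simps using that g
        by (intro N.finsum_cong') (auto simp: N.free_mod_carrier N.smult_assoc1)
      then show ?thesis unfolding h_def using N.finsum_smult_ldistr[OF B that(1) c[OF that(2)]] by simp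
    qed
  qed
  moreover have "h (unit_vec R b) = g b" if b: "b \<in> B" for b
  proof -
    have "h (unit_vec R b) = (\<Oplus>\<^bsub>N\<^esub>c\<in>B. if b = c then g c else \<zero>\<^bsub>N\<^esub>)"
      unfolding h_def using g by (intro N.finsum_cong') (auto simp: unit_vec_def)
    also have "\<dots> = g b" using N.finsum_singleton[OF b B, of g] g by auto
    finally show ?thesis .
  qed
  ultimately show ?thesis using that by blast
qed

lemma free_mod_hom_lift:
  assumes N: "module R N" and P: "module R P" and B: "finite B"
    and g: "g \<in> mod_hom R N P" and h: "h \<in> mod_hom R (free_mod R B) P"
    and im: "\<And>b. b \<in> B \<Longrightarrow> h (unit_vec R b) \<in> g ` carrier N"
  obtains h' where "h' \<in> mod_hom R (free_mod R B) N"
    "\<And>v. v \<in> carrier (free_mod R B) \<Longrightarrow> g (h' v) = h v"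
proof -
  interpret N: module R N by fact
  have "\<forall>b\<in>B. \<exists>z\<in>carrier N. g z = h (unit_vec R b)"
    using im by (metis imageE)
  then obtain z where z: "\<And>b. b \<in> B \<Longrightarrow> z b \<in> carrier N" "\<And>b. b \<in> B \<Longrightarrow> g (z b) = h (unit_vec R b)"
    by metis
  obtain h' where h': "h' \<in> mod_hom R (free_mod R B) N" "\<And>b. b \<in> B \<Longrightarrow> h' (unit_vec R b) = z b"
    using free_mod_hom_exists[of R N B z, OF N B z(1)] by auto
  have "g (h' v) = h v" if "v \<in> carrier (free_mod R B)" for v
    by (rule free_mod_hom_eqI[OF P B mod_hom_comp[OF h'(1) g] h _ that]) (simp add: h' z)
  then show ?thesis using that h'(1) by blast
qed

lemma free_mod_projective:
  fixes R :: "('a, 'b) ring_scheme" and B :: "'x set"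
  assumes R: "cring R" and B: "finite B"
  shows "is_projective_module R (free_mod R B)"
  unfolding is_projective_module_def
proof (intro conjI allI ballI impI)
  show "module R (free_mod R B)" using R by (rule cring.free_mod_module)
  fix N :: "('a, ('x \<Rightarrow> 'a) \<Rightarrow> 'a) module" and N' :: "('a, 'x \<Rightarrow> 'a) module" and g h
  assume g: "g \<in> mod_hom R N N'" and h: "h \<in> mod_hom R (free_mod R B) N'"
    and "module R N \<and> module R N' \<and> g ` carrier N = carrier N'"
  then have "module R N" "module R N'" "\<And>b. b \<in> B \<Longrightarrow> h (unit_vec R b) \<in> g ` carrier N"
    using mod_homD(1)[OF h cring.unit_vec_closed[OF R]] by auto
  from free_mod_hom_lift[OF this(1,2) B g h this(3)]
  show "\<exists>h'\<in>mod_hom R (free_mod R B) N. \<forall>x\<in>carrier (free_mod R B). g (h' x) = h x" by metis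
qed

section \<open>Torsion in high syzygies\<close>

text \<open>The cyclic submodules generated by \<open>x\<close>, \<open>a x\<close>, \<open>a\<^sup>2 x\<close> and so on decrease. An equality \<open>a\<^sup>j x = r a\<^bsup>j+1\<^esup> x\<close> gives
\<open>(1 - r a) a\<^sup>j x = 0\<close>, and \<open>1 - r a\<close> is a unit because \<open>a\<close> lies in the maximal ideal. So if no \<open>a\<^sup>j x\<close> vanishes,
the chain is strict and reading it backwards gives ascending chains of every length.\<close>

lemma finite_length_torsion:
  assumes R: "noetherian_ring R" "local_ring R \<mm>" and N: "module R N"
    and len: "module_length R N \<noteq> \<infinity>" and a: "a \<in> \<mm>" and x: "x \<in> carrier N"
  shows "\<exists>n::nat. (a [^]\<^bsub>R\<^esub> n) \<odot>\<^bsub>N\<^esub> x = \<zero>\<^bsub>N\<^esub>"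
proof (rule ccontr)
  assume neg: "\<not> ?thesis"
  interpret N: module R N by fact
  interpret m: maximalideal \<mm> R using local_ringD[OF R(2)] by blast
  have aR: "a \<in> carrier R" using a by (rule m.Icarr)
  define y where "y j = (a [^]\<^bsub>R\<^esub> j) \<odot>\<^bsub>N\<^esub> x" for j :: nat
  have y: "y j \<in> carrier N" for j using aR x by (simp add: y_def)
  have ySuc: "y (Suc j) = a \<odot>\<^bsub>N\<^esub> y j" for j
    using aR x by (simp add: y_def N.smult_assoc1[symmetric] N.R.m_comm)
  define C where "C j = (\<lambda>r. r \<odot>\<^bsub>N\<^esub> y j) ` carrier R" for j
  have C: "submodule (C j) R N" for j
  proof (rule N.submoduleI)
    show "\<zero>\<^bsub>N\<^esub> \<in> C j" unfolding C_def using y[of j] by (intro image_eqI[of _ _ "\<zero>\<^bsub>R\<^esub>"]) auto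
    show "C j \<subseteq> carrier N" using y by (auto simp: C_def)
    fix u assume "u \<in> C j"
    then obtain r where r: "r \<in> carrier R" "u = r \<odot>\<^bsub>N\<^esub> y j" by (auto simp: C_def)
    show "\<ominus>\<^bsub>N\<^esub> u \<in> C j" unfolding C_def using r y[of j]
      by (intro image_eqI[of _ _ "\<ominus>\<^bsub>R\<^esub> r"]) (auto simp: N.smult_l_minus)
    show "s \<odot>\<^bsub>N\<^esub> u \<in> C j" if "s \<in> carrier R" for s unfolding C_def using r y[of j] that
      by (intro image_eqI[of _ _ "s \<otimes>\<^bsub>R\<^esub> r"]) (auto simp: N.smult_assoc1)
    show "u \<oplus>\<^bsub>N\<^esub> w \<in> C j" if w: "w \<in> C j" for w
    proof -
      obtain s where s: "s \<in> carrier R" "w = s \<odot>\<^bsub>N\<^esub> y j" using w by (auto simp: C_def)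
      show ?thesis unfolding C_def using r s y[of j]
        by (intro image_eqI[of _ _ "r \<oplus>\<^bsub>R\<^esub> s"]) (auto simp: N.smult_l_distr)
    qed
  qed
  have sub: "C (Suc j) \<subset> C j" for j
  proof
    show "C (Suc j) \<subseteq> C j"
    proof
      fix u assume "u \<in> C (Suc j)"
      then obtain r where r: "r \<in> carrier R" "u = r \<odot>\<^bsub>N\<^esub> (a \<odot>\<^bsub>N\<^esub> y j)"
        unfolding C_def ySuc by blast
      then show "u \<in> C j" unfolding C_def using y[of j] aR
        by (intro image_eqI[of _ _ "r \<otimes>\<^bsub>R\<^esub> a"]) (auto simp: N.smult_assoc1)
    qed
    show "C (Suc j) \<noteq> C j"
    proof
      assume eq: "C (Suc j) = C j"
      have "y j \<in> C j" unfolding C_def using y[of j] by (intro image_eqI[of _ _ "\<one>\<^bsub>R\<^esub>"]) auto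
      then have "y j \<in> C (Suc j)" using eq by simp
      then obtain r where r: "r \<in> carrier R" "y j = r \<odot>\<^bsub>N\<^esub> (a \<odot>\<^bsub>N\<^esub> y j)"
        unfolding C_def ySuc by blast
      define u where "u = \<one>\<^bsub>R\<^esub> \<ominus>\<^bsub>R\<^esub> r \<otimes>\<^bsub>R\<^esub> a"
      have u: "u \<in> carrier R" using r aR by (simp add: u_def)
      have ra: "r \<otimes>\<^bsub>R\<^esub> a \<in> \<mm>" using a r by (intro m.I_l_closed)
      have "u \<oplus>\<^bsub>R\<^esub> r \<otimes>\<^bsub>R\<^esub> a = \<one>\<^bsub>R\<^esub>"
        using r aR by (simp add: u_def a_minus_def N.R.a_assoc N.R.l_neg)
      then have "u \<notin> \<mm>" using m.a_closed[OF _ ra] m.one_imp_carrier m.I_notcarr by metis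
      then obtain v where v: "v \<in> carrier R" "v \<otimes>\<^bsub>R\<^esub> u = \<one>\<^bsub>R\<^esub>" using local_ring_unit[OF R u] by blast
      have "u \<odot>\<^bsub>N\<^esub> y j = y j \<oplus>\<^bsub>N\<^esub> \<ominus>\<^bsub>N\<^esub> (r \<odot>\<^bsub>N\<^esub> (a \<odot>\<^bsub>N\<^esub> y j))"
        using r(1) aR y[of j] by (simp add: u_def a_minus_def N.smult_l_distr N.smult_l_minus N.smult_assoc1)
      also have "\<dots> = \<zero>\<^bsub>N\<^esub>" using r(2) y[of j] by (simp add: N.r_neg)
      finally have "v \<odot>\<^bsub>N\<^esub> (u \<odot>\<^bsub>N\<^esub> y j) = \<zero>\<^bsub>N\<^esub>" using v by simp
      then have "y j = \<zero>\<^bsub>N\<^esub>" using v u y[of j] by (simp add: N.smult_assoc1[symmetric])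
      then show False using neg by (auto simp: y_def)
    qed
  qed
  have "enat n \<le> module_length R N" for n
    unfolding module_length_def
  proof (rule Sup_upper, rule CollectI, rule exI[of _ n], rule conjI[OF refl],
      rule exI[of _ "\<lambda>i. C (n - i)"], intro conjI)
    show "\<forall>i\<le>n. submodule (C (n - i)) R N" using C by blast
    show "\<forall>i<n. C (n - i) \<subset> C (n - Suc i)" using sub by (metis Suc_diff_Suc)
  qed
  then show False using len by (metis enat_ile enat_ord_simps(2) leD not_infinity_eq lessI)
qed

text \<open>The only power of the ideal that has to be related to local cohomology is the second one, by the reduction in
\<open>torsion_killed_by_ideal\<close>.\<close>

lemma local_cohomology_0_square:
  assumes R: "cring R" and I: "ideal I R" and x: "x \<in> carrier R"
    and sq: "\<forall>a\<in>I. \<forall>b\<in>I. a \<otimes>\<^bsub>R\<^esub> (b \<otimes>\<^bsub>R\<^esub> x) = \<zero>\<^bsub>R\<^esub>"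
  shows "x \<in> local_cohomology_0 R I"
proof -
  interpret cring R by fact
  interpret I: ideal I R by fact
  have eq: "I [^]\<^bsub>ideals_set R\<^esub> (2::nat) = ideal_prod R (ideal_prod R (carrier R) I) I"
    by (simp add: nat_pow_def numeral_2_eq_2 ideals_set_def)
  have le: "ideal_prod R (carrier R) I \<subseteq> I" using ideal_prod_inter[OF oneideal I] by blast
  have "a \<in> carrier R \<and> a \<otimes>\<^bsub>R\<^esub> x = \<zero>\<^bsub>R\<^esub>" if "a \<in> ideal_prod R (ideal_prod R (carrier R) I) I" for a
    using that
  proof (induction a rule: ideal_prod.induct)
    case (prod i j)
    then show ?case using le I.Icarr x sq by (auto simp: m_assoc)
  next
    case (sum s1 s2)
    then show ?case using x by (auto simp: l_distr)
  qed
  then show ?thesis unfolding local_cohomology_0_def using x eq by (intro CollectI conjI exI[of _ 2]) auto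
qed

text \<open>The resolution can be cut off at the injective map. All modules beyond it are replaced by the free module on the empty
basis, which is zero.\<close>

lemma proj_dim_finite_if_injective:
  fixes R :: "('a, 'b) ring_scheme" and \<beta> :: "nat \<Rightarrow> nat"
  assumes R: "cring R" and k: "k > 0"
    and res: "is_resolution R M (\<lambda>i. free_mod R {..<\<beta> i}) \<epsilon> f"
    and ker: "mod_ker (free_mod R {..<\<beta> k}) (free_mod R {..<\<beta> (k - 1)}) (f k) = {\<lambda>x. \<zero>\<^bsub>R\<^esub>}"
  shows "proj_dim R M \<noteq> \<infinity>"
proof -
  interpret cring R by fact
  define \<beta>' where "\<beta>' i = (if i \<le> k then \<beta> i else 0)" for i
  define P :: "nat \<Rightarrow> ('a, nat \<Rightarrow> 'a) module" where "P i = free_mod R {..<\<beta>' i}" for i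
  define f' where "f' i = (if i \<le> k then f i else (\<lambda>_ _. \<zero>\<^bsub>R\<^esub>))" for i
  have P0: "carrier (P i) = {\<lambda>x. \<zero>\<^bsub>R\<^esub>}" if "i > k" for i
    using that by (auto simp: P_def \<beta>'_def free_mod_carrier)
  have Pk: "P i = free_mod R {..<\<beta> i}" "f' i = f i" if "i \<le> k" for i
    using that by (simp_all add: P_def \<beta>'_def f'_def)
  have mod: "module R (P i)" for i by (simp add: P_def free_mod_module)
  have zero: "\<zero>\<^bsub>P i\<^esub> = (\<lambda>x. \<zero>\<^bsub>R\<^esub>)" for i by (simp add: P_def free_mod_simps)
  have zc: "(\<lambda>x. \<zero>\<^bsub>R\<^esub>) \<in> carrier (P i)" for i by (simp add: P_def free_mod_zero_closed)
  note r = res[unfolded is_resolution_def]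
  have "is_resolution R M P \<epsilon> f'"
    unfolding is_resolution_def
  proof (intro conjI allI impI)
    show "\<epsilon> \<in> mod_hom R (P 0) M" "\<epsilon> ` carrier (P 0) = carrier M" using r by (auto simp: Pk)
    show "f' 1 ` carrier (P 1) = mod_ker (P 0) M \<epsilon>" using r k by (auto simp: Pk)
    fix i :: nat assume i: "i > 0"
    show "f' i \<in> mod_hom R (P i) (P (i - 1))"
    proof (cases "i \<le> k")
      case True
      then show ?thesis using r i by (auto simp: Pk)
    next
      case False
      then show ?thesis
        by (intro mod_homI) (auto simp: f'_def zc, auto simp: P_def free_mod_simps)
    qed
    show "f' (i + 1) ` carrier (P (i + 1)) = mod_ker (P i) (P (i - 1)) (f' i)"
    proof (cases "i + 1 \<le> k")
      case True
      then show ?thesis using r i by (auto simp: Pk)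
    next
      case F: False
      then have "f' (i + 1) ` carrier (P (i + 1)) = {\<lambda>x. \<zero>\<^bsub>R\<^esub>}" by (simp add: P0 f'_def)
      also have "{\<lambda>x. \<zero>\<^bsub>R\<^esub>} = mod_ker (P i) (P (i - 1)) (f' i)"
      proof (cases "i = k")
        case True
        then show ?thesis using ker by (simp add: Pk)
      next
        case False
        then show ?thesis using F P0[of i] zero by (auto simp: mod_ker_def f'_def)
      qed
      finally show ?thesis .
    qed
  qed (rule mod)
  moreover have "is_projective_module R (P i)" for i
    unfolding P_def by (rule free_mod_projective[OF R]) simp
  ultimately have "proj_dim R M \<le> enat k"
    unfolding proj_dim_def using P0 zero by (intro Inf_lower CollectI exI conjI refl) auto
  then show ?thesis by (metis infinity_ileE)
qed

text \<open>The image of \<open>v\<close> is the sum of the \<open>v b h (e\<^sub>b)\<close>, and each \<open>h (e\<^sub>b)\<close> has its entries in \<open>I\<close>. This is how the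
minimality of a resolution enters.\<close>

lemma hom_into_ideal_multiple_kills_socle:
  assumes R: "cring R" and I: "ideal I R" and B: "finite B"
    and h: "h \<in> mod_hom R (free_mod R B) (free_mod R C)"
    and min: "\<And>v j. v \<in> carrier (free_mod R B) \<Longrightarrow> h v j \<in> I"
    and v: "v \<in> carrier (free_mod R B)" "\<And>a b. a \<in> I \<Longrightarrow> a \<otimes>\<^bsub>R\<^esub> v b = \<zero>\<^bsub>R\<^esub>"
  shows "h v = (\<lambda>x. \<zero>\<^bsub>R\<^esub>)"
proof -
  interpret cring R by fact
  interpret I: ideal I R by fact
  have "h v = \<zero>\<^bsub>free_mod R C\<^esub>"
  proof (rule free_mod_hom_zeroI[OF free_mod_module B h v(1)])
    fix b assume b: "b \<in> B"
    have e: "h (unit_vec R b) j \<in> I" for j by (rule min[OF unit_vec_closed[OF b]])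
    have "v b \<otimes>\<^bsub>R\<^esub> h (unit_vec R b) j = \<zero>\<^bsub>R\<^esub>" for j
      using v(2)[OF e[of j], of b] I.Icarr[OF e[of j]] v(1) m_comm by (simp add: free_mod_carrier)
    then show "v b \<odot>\<^bsub>free_mod R C\<^esub> h (unit_vec R b) = \<zero>\<^bsub>free_mod R C\<^esub>"
      by (simp add: free_mod_simps)
  qed
  then show ?thesis by (simp add: free_mod_simps)
qed

text \<open>Let \<open>F\<^sub>i = R\<^bsup>\<beta> i\<^esup>\<close> and suppose that every element of \<open>N = ker f\<^sub>k\<close> is \<open>\<mm>\<close>-power torsion. Then \<open>\<mm> N = 0\<close> by
\<open>torsion_killed_by_ideal\<close>. Take
\<open>w\<close> in \<open>F\<^bsub>k-1\<^esub>\<close> with \<open>\<mm> w = 0\<close>. By minimality \<open>f\<^bsub>k-1\<^esub>\<close> kills \<open>w\<close>, so \<open>w = f\<^sub>k v\<close> for some \<open>v\<close>; this step needs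
the map \<open>f\<^bsub>k-1\<^esub>\<close> between free modules, whence \<open>k \<ge> 2\<close>. Now \<open>\<mm> v \<subseteq> N\<close>, so \<open>\<mm>\<^sup>2 v = 0\<close>, so \<open>\<mm> v = 0\<close>, and by minimality
again \<open>w = f\<^sub>k v = 0\<close>. Thus \<open>F\<^bsub>k-1\<^esub>\<close> has no nonzero element killed by \<open>\<mm>\<close>. If it is nonzero, neither has \<open>R\<close>, so
\<open>N = 0\<close>. If it is zero, then \<open>N = F\<^sub>k\<close> is contained in \<open>\<mm> F\<^sub>k\<close>, and \<open>N = 0\<close> as well. In both cases \<open>f\<^sub>k\<close> is injective
and the projective dimension is finite.\<close>

lemma higher_syzygy_not_torsion:
  fixes R :: "('a, 'b) ring_scheme"
  assumes R: "noetherian_ring R" "local_ring R \<mm>"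
    and sq: "\<And>x. x \<in> carrier R \<Longrightarrow> \<forall>a\<in>\<mm>. \<forall>b\<in>\<mm>. a \<otimes>\<^bsub>R\<^esub> (b \<otimes>\<^bsub>R\<^esub> x) = \<zero>\<^bsub>R\<^esub>
               \<Longrightarrow> \<forall>a\<in>\<mm>. a \<otimes>\<^bsub>R\<^esub> x = \<zero>\<^bsub>R\<^esub>"
    and pd: "proj_dim R M = \<infinity>"
    and mfr: "minimal_free_resolution R \<mm> M \<beta> \<epsilon> f"
    and k: "k \<ge> 2"
  obtains v a where "v \<in> mod_ker (free_mod R {..<\<beta> k}) (free_mod R {..<\<beta> (k - 1)}) (f k)" "a \<in> \<mm>"
    "\<And>n::nat. (a [^]\<^bsub>R\<^esub> n) \<odot>\<^bsub>free_mod R {..<\<beta> k}\<^esub> v \<noteq> \<zero>\<^bsub>free_mod R {..<\<beta> k}\<^esub>"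
proof (rule ccontr)
  assume "\<not> thesis"
  note no_witness = that[THEN notE[OF \<open>\<not> thesis\<close>]]
  define F :: "nat \<Rightarrow> ('a, nat \<Rightarrow> 'a) module" where "F i = free_mod R {..<\<beta> i}" for i
  define N where "N = mod_ker (F k) (F (k - 1)) (f k)"
  have tors: "\<exists>n::nat. (a [^]\<^bsub>R\<^esub> n) \<odot>\<^bsub>F k\<^esub> v = \<zero>\<^bsub>F k\<^esub>" if "v \<in> N" "a \<in> \<mm>" for v a
    using that no_witness[of v a] unfolding N_def F_def by blast
  interpret cring R using local_ringD[OF R(2)] by blast
  interpret m: maximalideal \<mm> R using local_ringD[OF R(2)] by blast
  have mI: "ideal \<mm> R" using local_ringD[OF R(2)] by blast
  have res: "is_resolution R M (\<lambda>i. F i) \<epsilon> f"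
    and min: "\<And>i v j. i > 0 \<Longrightarrow> v \<in> carrier (F i) \<Longrightarrow> f i v j \<in> \<mm>"
    using mfr by (auto simp: minimal_free_resolution_def F_def)
  have hom: "f i \<in> mod_hom R (F i) (F (i - 1))"
    and exact: "f (i + 1) ` carrier (F (i + 1)) = mod_ker (F i) (F (i - 1)) (f i)" if "i > 0" for i
    using res that by (auto simp: is_resolution_def)
  interpret F: module R "F i" for i unfolding F_def by (rule free_mod_module)
  have zero: "\<zero>\<^bsub>F i\<^esub> = (\<lambda>x. \<zero>\<^bsub>R\<^esub>)" and smult: "a \<odot>\<^bsub>F i\<^esub> v = (\<lambda>x. a \<otimes>\<^bsub>R\<^esub> v x)" for i a v
    by (simp_all add: F_def free_mod_simps)
  have coord: "v x \<in> carrier R" if "v \<in> carrier (F i)" for i v x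
    using that by (simp add: F_def free_mod_carrier)
  have kills: "f i v = \<zero>\<^bsub>F (i - 1)\<^esub>"
    if "i > 0" "v \<in> carrier (F i)" "\<And>a. a \<in> \<mm> \<Longrightarrow> a \<odot>\<^bsub>F i\<^esub> v = \<zero>\<^bsub>F i\<^esub>" for i v
    unfolding zero
  proof (rule hom_into_ideal_multiple_kills_socle[OF cring_axioms mI finite_lessThan, where h = "f i" and v = v])
    show "f i \<in> mod_hom R (free_mod R {..<\<beta> i}) (free_mod R {..<\<beta> (i - 1)})"
      using hom[OF that(1)] by (simp add: F_def)
    show "v \<in> carrier (free_mod R {..<\<beta> i})" using that(2) by (simp add: F_def)
    show "f i w j \<in> \<mm>" if "w \<in> carrier (free_mod R {..<\<beta> i})" for w j
      using min[OF \<open>i > 0\<close>] that by (simp add: F_def)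
    show "a \<otimes>\<^bsub>R\<^esub> v b = \<zero>\<^bsub>R\<^esub>" if "a \<in> \<mm>" for a b
      using \<open>\<And>a. a \<in> \<mm> \<Longrightarrow> _\<close>[OF that] unfolding smult zero by (metis fun_cong)
  qed
  have sqF: "\<forall>a\<in>\<mm>. a \<odot>\<^bsub>F i\<^esub> x = \<zero>\<^bsub>F i\<^esub>"
    if "x \<in> carrier (F i)" "\<forall>a\<in>\<mm>. \<forall>b\<in>\<mm>. a \<odot>\<^bsub>F i\<^esub> (b \<odot>\<^bsub>F i\<^esub> x) = \<zero>\<^bsub>F i\<^esub>" for i x
  proof -
    have "\<forall>a\<in>\<mm>. a \<otimes>\<^bsub>R\<^esub> x j = \<zero>\<^bsub>R\<^esub>" for j
    proof (rule sq[OF coord[OF that(1)]], intro ballI)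
      fix a b assume "a \<in> \<mm>" "b \<in> \<mm>"
      then have "(\<lambda>j. a \<otimes>\<^bsub>R\<^esub> (b \<otimes>\<^bsub>R\<^esub> x j)) = (\<lambda>j. \<zero>\<^bsub>R\<^esub>)" using that(2) unfolding smult zero by blast
      then show "a \<otimes>\<^bsub>R\<^esub> (b \<otimes>\<^bsub>R\<^esub> x j) = \<zero>\<^bsub>R\<^esub>" by (rule fun_cong)
    qed
    then show ?thesis unfolding smult zero by auto
  qed
  have k0: "k > 0" "k - 1 > 0" using k by auto
  have Nsub: "v \<in> carrier (F k)" "f k v = \<zero>\<^bsub>F (k - 1)\<^esub>" if "v \<in> N" for v
    using that by (auto simp: N_def mod_ker_def)
  have Nkilled: "a \<odot>\<^bsub>F k\<^esub> v = \<zero>\<^bsub>F k\<^esub>" if v: "v \<in> N" and a: "a \<in> \<mm>" for v a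
    by (rule F.torsion_killed_by_ideal[OF R(1) mI sqF Nsub(1)[OF v] tors[OF v] a])
  have socle: "w = \<zero>\<^bsub>F (k - 1)\<^esub>"
    if w: "w \<in> carrier (F (k - 1))" "\<And>a. a \<in> \<mm> \<Longrightarrow> a \<odot>\<^bsub>F (k - 1)\<^esub> w = \<zero>\<^bsub>F (k - 1)\<^esub>" for w
  proof -
    have "w \<in> mod_ker (F (k - 1)) (F (k - 1 - 1)) (f (k - 1))"
      using kills[OF k0(2) w] w by (simp add: mod_ker_def)
    then obtain v where v: "v \<in> carrier (F k)" "w = f k v"
      using exact[OF k0(2)] k0 by auto
    have "a \<odot>\<^bsub>F k\<^esub> v \<in> N" if "a \<in> \<mm>" for a
      using that v w(2)[OF that] mod_homD(3)[OF hom[OF k0(1)] _ v(1), of a] m.Icarr[OF that]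
      by (simp add: N_def mod_ker_def)
    then have "\<forall>a\<in>\<mm>. \<forall>b\<in>\<mm>. a \<odot>\<^bsub>F k\<^esub> (b \<odot>\<^bsub>F k\<^esub> v) = \<zero>\<^bsub>F k\<^esub>" using Nkilled by blast
    from sqF[OF v(1) this] show ?thesis using kills[OF k0(1) v(1)] v(2) by blast
  qed
  have "N = {\<zero>\<^bsub>F k\<^esub>}"
  proof (cases "\<beta> (k - 1) = 0")
    case True
    have "carrier (F (k - 1)) = {\<zero>\<^bsub>F (k - 1)\<^esub>}"
      using True by (auto simp: F_def free_mod_carrier free_mod_simps)
    then have NF: "N = carrier (F k)" using mod_homD(1)[OF hom[OF k0(1)]] by (auto simp: N_def mod_ker_def)
    have "\<beta> k = 0"
    proof (rule ccontr)
      assume "\<beta> k \<noteq> 0"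
      then have "unit_vec R 0 \<in> N" unfolding NF F_def by (intro unit_vec_closed) auto
      then obtain u where "u \<in> carrier (F (k + 1))" "unit_vec R 0 = f (k + 1) u"
        using exact[OF k0(1)] by (auto simp: N_def)
      then have "unit_vec R (0::nat) (0::nat) \<in> \<mm>" using min[of "k + 1" u 0] by simp
      then show False using m.one_imp_carrier m.I_notcarr by (auto simp: unit_vec_def)
    qed
    then show ?thesis unfolding NF by (auto simp: F_def free_mod_carrier free_mod_simps)
  next
    case False
    have T: "r = \<zero>\<^bsub>R\<^esub>" if r: "r \<in> carrier R" "\<And>a. a \<in> \<mm> \<Longrightarrow> a \<otimes>\<^bsub>R\<^esub> r = \<zero>\<^bsub>R\<^esub>" for r
    proof -
      define w where "w = (\<lambda>j::nat. if j = 0 then r else \<zero>\<^bsub>R\<^esub>)"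
      have "w = \<zero>\<^bsub>F (k - 1)\<^esub>"
      proof (rule socle)
        show "w \<in> carrier (F (k - 1))"
          using False r by (auto simp: F_def w_def free_mod_carrier)
        show "a \<odot>\<^bsub>F (k - 1)\<^esub> w = \<zero>\<^bsub>F (k - 1)\<^esub>" if "a \<in> \<mm>" for a
          unfolding smult zero w_def using r(2)[OF that] m.Icarr[OF that] by auto
      qed
      then have "w 0 = \<zero>\<^bsub>R\<^esub>" by (simp add: zero)
      then show ?thesis by (simp add: w_def)
    qed
    have "v = \<zero>\<^bsub>F k\<^esub>" if v: "v \<in> N" for v
    proof -
      have "v j = \<zero>\<^bsub>R\<^esub>" for j
      proof (rule T[OF coord[OF Nsub(1)[OF v]]])
        fix a assume "a \<in> \<mm>"
        then have "(\<lambda>j. a \<otimes>\<^bsub>R\<^esub> v j) = (\<lambda>j. \<zero>\<^bsub>R\<^esub>)" using Nkilled[OF v] unfolding smult zero by blast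
        then show "a \<otimes>\<^bsub>R\<^esub> v j = \<zero>\<^bsub>R\<^esub>" by (rule fun_cong)
      qed
      then show ?thesis by (auto simp: zero)
    qed
    moreover have "\<zero>\<^bsub>F k\<^esub> \<in> N"
      using mod_hom_zero[OF hom[OF k0(1)] F.module_axioms F.module_axioms] by (simp add: N_def mod_ker_def)
    ultimately show ?thesis by blast
  qed
  then have "mod_ker (free_mod R {..<\<beta> k}) (free_mod R {..<\<beta> (k - 1)}) (f k) = {\<lambda>x. \<zero>\<^bsub>R\<^esub>}"
    unfolding zero by (simp add: N_def F_def)
  from proj_dim_finite_if_injective[OF cring_axioms k0(1) res[unfolded F_def] this] pd
  show False by simp
qed

section \<open>Fractions\<close>

locale localization = module R M for R (structure) and M (structure) +
  fixes S :: "'a set"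
  assumes S_closed: "s \<in> S \<Longrightarrow> s \<in> carrier R"
    and S_one: "\<one> \<in> S"
    and S_mult: "s \<in> S \<Longrightarrow> t \<in> S \<Longrightarrow> s \<otimes> t \<in> S"
begin

abbreviation frac :: "'c \<Rightarrow> 'a \<Rightarrow> ('c \<times> 'a) set" where
  "frac \<equiv> loc_frac R S M"

lemma mem_frac_iff:
  assumes "x \<in> carrier M" "s \<in> S"
  shows "(y, t) \<in> frac x s \<longleftrightarrow> y \<in> carrier M \<and> t \<in> S \<and> (\<exists>u\<in>S. (u \<otimes> t) \<odot>\<^bsub>M\<^esub> x = (u \<otimes> s) \<odot>\<^bsub>M\<^esub> y)"
  using assms by (auto simp: loc_frac_def smult_assoc1 S_closed)

lemma frac_self: "x \<in> carrier M \<Longrightarrow> s \<in> S \<Longrightarrow> (x, s) \<in> frac x s"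
  using S_one by (auto simp: mem_frac_iff)

lemma frac_trans:
  assumes x: "x \<in> carrier M" "s \<in> S" and yt: "(y, t) \<in> frac x s" and zw: "(z, w) \<in> frac y t"
  shows "(z, w) \<in> frac x s"
proof -
  have y: "y \<in> carrier M" "t \<in> S" using yt x by (auto simp: mem_frac_iff)
  have z: "z \<in> carrier M" "w \<in> S" using zw y by (auto simp: mem_frac_iff)
  obtain u where u: "u \<in> S" "(u \<otimes> t) \<odot>\<^bsub>M\<^esub> x = (u \<otimes> s) \<odot>\<^bsub>M\<^esub> y" using yt x by (auto simp: mem_frac_iff)
  obtain v where v: "v \<in> S" "(v \<otimes> w) \<odot>\<^bsub>M\<^esub> y = (v \<otimes> t) \<odot>\<^bsub>M\<^esub> z" using zw y by (auto simp: mem_frac_iff)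
  note c = S_closed[OF u(1)] S_closed[OF v(1)] S_closed[OF x(2)] S_closed[OF y(2)] S_closed[OF z(2)]
  have "(u \<otimes> v \<otimes> t \<otimes> w) \<odot>\<^bsub>M\<^esub> x = ((v \<otimes> w) \<otimes> (u \<otimes> t)) \<odot>\<^bsub>M\<^esub> x"
    using c by (simp add: R.m_ac)
  also have "\<dots> = (v \<otimes> w) \<odot>\<^bsub>M\<^esub> ((u \<otimes> s) \<odot>\<^bsub>M\<^esub> y)" using c x u by (simp add: smult_assoc1)
  also have "\<dots> = (u \<otimes> s) \<odot>\<^bsub>M\<^esub> ((v \<otimes> t) \<odot>\<^bsub>M\<^esub> z)"
    using c y v(2) by (simp add: smult_left_commute[of "v \<otimes> w" "u \<otimes> s" y])
  also have "\<dots> = ((u \<otimes> s) \<otimes> (v \<otimes> t)) \<odot>\<^bsub>M\<^esub> z" using c z by (simp only: smult_assoc1 R.m_closed)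
  also have "\<dots> = (u \<otimes> v \<otimes> t \<otimes> s) \<odot>\<^bsub>M\<^esub> z" using c by (simp add: R.m_ac)
  finally show ?thesis
    using x z S_mult[OF S_mult[OF u(1) v(1)] y(2)] by (auto simp: mem_frac_iff)
qed

lemma frac_sym:
  assumes "x \<in> carrier M" "s \<in> S" "(y, t) \<in> frac x s"
  shows "(x, s) \<in> frac y t"
  using assms by (auto simp: mem_frac_iff) (metis mem_frac_iff)

lemma frac_eqI:
  assumes "x \<in> carrier M" "s \<in> S" "(y, t) \<in> frac x s"
  shows "frac y t = frac x s"
proof -
  have y: "y \<in> carrier M" "t \<in> S" using assms by (auto simp: mem_frac_iff)
  show ?thesis
    using frac_trans[OF assms] frac_trans[OF y frac_sym[OF assms]] by auto
qed

lemma frac_eq_iff: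
  assumes "x \<in> carrier M" "s \<in> S" "y \<in> carrier M" "t \<in> S"
  shows "frac x s = frac y t \<longleftrightarrow> (\<exists>u\<in>S. (u \<otimes> t) \<odot>\<^bsub>M\<^esub> x = (u \<otimes> s) \<odot>\<^bsub>M\<^esub> y)"
proof -
  have "frac x s = frac y t \<longleftrightarrow> (y, t) \<in> frac x s"
    using frac_eqI[OF assms(1,2)] frac_self[OF assms(3,4)] by metis
  then show ?thesis using assms by (simp add: mem_frac_iff)
qed

lemma frac_cancel:
  assumes "x \<in> carrier M" "s \<in> S" "t \<in> S"
  shows "frac (t \<odot>\<^bsub>M\<^esub> x) (t \<otimes> s) = frac x s"
  using assms S_one S_mult[OF assms(3,2)]
  by (subst frac_eq_iff) (auto intro!: bexI[of _ \<one>] simp: S_closed R.m_comm[of t s] smult_assoc1)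

lemma frac_zero:
  assumes "s \<in> S"
  shows "frac \<zero>\<^bsub>M\<^esub> s = frac \<zero>\<^bsub>M\<^esub> \<one>"
  using assms S_one by (subst frac_eq_iff) (auto simp: S_closed)

lemma loc_module_carrier: "carrier (loc_module R S M) = {frac x s | x s. x \<in> carrier M \<and> s \<in> S}"
  by (simp add: loc_module_def)

lemma loc_module_add:
  assumes x: "x \<in> carrier M" "s \<in> S" and y: "y \<in> carrier M" "t \<in> S"
  shows "frac x s \<oplus>\<^bsub>loc_module R S M\<^esub> frac y t = frac (t \<odot>\<^bsub>M\<^esub> x \<oplus>\<^bsub>M\<^esub> s \<odot>\<^bsub>M\<^esub> y) (s \<otimes> t)"
proof -
  have *: "frac (t' \<odot>\<^bsub>M\<^esub> x' \<oplus>\<^bsub>M\<^esub> s' \<odot>\<^bsub>M\<^esub> y') (s' \<otimes> t') = frac (t \<odot>\<^bsub>M\<^esub> x \<oplus>\<^bsub>M\<^esub> s \<odot>\<^bsub>M\<^esub> y) (s \<otimes> t)"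
    if x'm: "(x', s') \<in> frac x s" and y'm: "(y', t') \<in> frac y t" for x' s' y' t'
  proof -
    have x': "x' \<in> carrier M" "s' \<in> S" using x'm x by (auto simp: mem_frac_iff)
    have y': "y' \<in> carrier M" "t' \<in> S" using y'm y by (auto simp: mem_frac_iff)
    obtain u where u: "u \<in> S" "(u \<otimes> s') \<odot>\<^bsub>M\<^esub> x = (u \<otimes> s) \<odot>\<^bsub>M\<^esub> x'" using x'm x by (auto simp: mem_frac_iff)
    obtain v where v: "v \<in> S" "(v \<otimes> t') \<odot>\<^bsub>M\<^esub> y = (v \<otimes> t) \<odot>\<^bsub>M\<^esub> y'" using y'm y by (auto simp: mem_frac_iff)
    note c = S_closed[OF u(1)] S_closed[OF v(1)] S_closed[OF x(2)] S_closed[OF y(2)]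
      S_closed[OF x'(2)] S_closed[OF y'(2)]
    have X: "(u \<otimes> v \<otimes> (s' \<otimes> t') \<otimes> t) \<odot>\<^bsub>M\<^esub> x = (u \<otimes> v \<otimes> (s \<otimes> t) \<otimes> t') \<odot>\<^bsub>M\<^esub> x'"
    proof -
      have "(u \<otimes> v \<otimes> (s' \<otimes> t') \<otimes> t) \<odot>\<^bsub>M\<^esub> x = ((v \<otimes> t' \<otimes> t) \<otimes> (u \<otimes> s')) \<odot>\<^bsub>M\<^esub> x"
        using c by (simp add: R.m_ac)
      also have "\<dots> = ((v \<otimes> t' \<otimes> t) \<otimes> (u \<otimes> s)) \<odot>\<^bsub>M\<^esub> x'"
        using c x x' u(2) by (simp only: smult_assoc1[of "v \<otimes> t' \<otimes> t"] R.m_closed)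
      also have "\<dots> = (u \<otimes> v \<otimes> (s \<otimes> t) \<otimes> t') \<odot>\<^bsub>M\<^esub> x'" using c by (simp add: R.m_ac)
      finally show ?thesis .
    qed
    have Y: "(u \<otimes> v \<otimes> (s' \<otimes> t') \<otimes> s) \<odot>\<^bsub>M\<^esub> y = (u \<otimes> v \<otimes> (s \<otimes> t) \<otimes> s') \<odot>\<^bsub>M\<^esub> y'"
    proof -
      have "(u \<otimes> v \<otimes> (s' \<otimes> t') \<otimes> s) \<odot>\<^bsub>M\<^esub> y = ((u \<otimes> s' \<otimes> s) \<otimes> (v \<otimes> t')) \<odot>\<^bsub>M\<^esub> y"
        using c by (simp add: R.m_ac)
      also have "\<dots> = ((u \<otimes> s' \<otimes> s) \<otimes> (v \<otimes> t)) \<odot>\<^bsub>M\<^esub> y'"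
        using c y y' v(2) by (simp only: smult_assoc1[of "u \<otimes> s' \<otimes> s"] R.m_closed)
      also have "\<dots> = (u \<otimes> v \<otimes> (s \<otimes> t) \<otimes> s') \<odot>\<^bsub>M\<^esub> y'" using c by (simp add: R.m_ac)
      finally show ?thesis .
    qed
    have "(u \<otimes> v \<otimes> (s' \<otimes> t')) \<odot>\<^bsub>M\<^esub> (t \<odot>\<^bsub>M\<^esub> x \<oplus>\<^bsub>M\<^esub> s \<odot>\<^bsub>M\<^esub> y)
        = (u \<otimes> v \<otimes> (s' \<otimes> t') \<otimes> t) \<odot>\<^bsub>M\<^esub> x \<oplus>\<^bsub>M\<^esub> (u \<otimes> v \<otimes> (s' \<otimes> t') \<otimes> s) \<odot>\<^bsub>M\<^esub> y"
      using c x y by (simp add: smult_r_distr smult_assoc1)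
    also have "\<dots> = (u \<otimes> v \<otimes> (s \<otimes> t)) \<odot>\<^bsub>M\<^esub> (t' \<odot>\<^bsub>M\<^esub> x' \<oplus>\<^bsub>M\<^esub> s' \<odot>\<^bsub>M\<^esub> y')"
      unfolding X Y using c x' y' by (simp add: smult_r_distr smult_assoc1)
    finally show ?thesis
      using c x y x' y' u v S_mult by (intro frac_eqI) (auto simp: mem_frac_iff intro!: bexI[of _ "u \<otimes> v"])
  qed
  have "frac x s \<oplus>\<^bsub>loc_module R S M\<^esub> frac y t
      = (\<Union>(x', s')\<in>frac x s. \<Union>(y', t')\<in>frac y t. frac (t' \<odot>\<^bsub>M\<^esub> x' \<oplus>\<^bsub>M\<^esub> s' \<odot>\<^bsub>M\<^esub> y') (s' \<otimes> t'))"
    by (simp add: loc_module_def)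
  also have "\<dots> = frac (t \<odot>\<^bsub>M\<^esub> x \<oplus>\<^bsub>M\<^esub> s \<odot>\<^bsub>M\<^esub> y) (s \<otimes> t)" (is "?U = ?f")
  proof
    show "?U \<subseteq> ?f" using * by fast
    show "?f \<subseteq> ?U" using frac_self[OF x] frac_self[OF y] by blast
  qed
  finally show ?thesis .
qed

end

lemma (in cring) self_module_module: "module R (self_module R)"
proof -
  have "abelian_group (self_module R)"
    by (rule abelian_groupI) (auto simp: self_module_def a_ac intro!: bexI[of _ "\<ominus> _"] l_neg)
  then show ?thesis
    by (intro moduleI) (auto simp: self_module_def is_cring l_distr r_distr m_assoc)
qed

lemma (in cring) self_module_simps:
  "carrier (self_module R) = carrier R" "\<zero>\<^bsub>self_module R\<^esub> = \<zero>"
  "a \<oplus>\<^bsub>self_module R\<^esub> b = a \<oplus> b" "a \<odot>\<^bsub>self_module R\<^esub> b = a \<otimes> b"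
  by (simp_all add: self_module_def)

context localization
begin

lemma localization_self: "localization R (self_module R) S"
  using R.self_module_module S_closed S_one S_mult
  by (simp add: localization_def localization_axioms_def)

sublocale self: localization R "self_module R" S
  by (rule localization_self)

lemma loc_smult:
  assumes a: "a \<in> carrier R" "s \<in> S" and x: "x \<in> carrier M" "t \<in> S"
  shows "self.frac a s \<odot>\<^bsub>loc_module R S M\<^esub> frac x t = frac (a \<odot>\<^bsub>M\<^esub> x) (s \<otimes> t)"
proof -
  have *: "frac (a' \<odot>\<^bsub>M\<^esub> x') (s' \<otimes> t') = frac (a \<odot>\<^bsub>M\<^esub> x) (s \<otimes> t)"
    if a'm: "(a', s') \<in> self.frac a s" and x'm: "(x', t') \<in> frac x t" for a' s' x' t'
  proof -
    have a': "a' \<in> carrier R" "s' \<in> S" using a'm a by (auto simp: self.mem_frac_iff R.self_module_simps)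
    have x': "x' \<in> carrier M" "t' \<in> S" using x'm x by (auto simp: mem_frac_iff)
    obtain u where u: "u \<in> S" "u \<otimes> s' \<otimes> a = u \<otimes> s \<otimes> a'"
      using a'm a by (auto simp: self.mem_frac_iff R.self_module_simps)
    obtain v where v: "v \<in> S" "(v \<otimes> t') \<odot>\<^bsub>M\<^esub> x = (v \<otimes> t) \<odot>\<^bsub>M\<^esub> x'" using x'm x by (auto simp: mem_frac_iff)
    note c = S_closed[OF u(1)] S_closed[OF v(1)] S_closed[OF a(2)] S_closed[OF x(2)]
      S_closed[OF a'(2)] S_closed[OF x'(2)]
    have "(u \<otimes> v \<otimes> (s' \<otimes> t')) \<odot>\<^bsub>M\<^esub> (a \<odot>\<^bsub>M\<^esub> x) = ((u \<otimes> s' \<otimes> a) \<otimes> (v \<otimes> t')) \<odot>\<^bsub>M\<^esub> x"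
      using c a x by (simp add: smult_assoc1[symmetric] R.m_ac)
    also have "\<dots> = ((u \<otimes> s \<otimes> a') \<otimes> (v \<otimes> t)) \<odot>\<^bsub>M\<^esub> x'"
      using c a' x x' v(2) unfolding u(2) by (simp only: smult_assoc1[of "u \<otimes> s \<otimes> a'"] R.m_closed)
    also have "\<dots> = (u \<otimes> v \<otimes> (s \<otimes> t)) \<odot>\<^bsub>M\<^esub> (a' \<odot>\<^bsub>M\<^esub> x')"
      using c a' x' by (simp add: smult_assoc1[symmetric] R.m_ac)
    finally show ?thesis
      using c a x a' x' u v S_mult by (intro frac_eqI) (auto simp: mem_frac_iff intro!: bexI[of _ "u \<otimes> v"])
  qed
  have "self.frac a s \<odot>\<^bsub>loc_module R S M\<^esub> frac x t
      = (\<Union>(a', s')\<in>self.frac a s. \<Union>(x', t')\<in>frac x t. frac (a' \<odot>\<^bsub>M\<^esub> x') (s' \<otimes> t'))"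
    by (simp add: loc_module_def)
  also have "\<dots> = frac (a \<odot>\<^bsub>M\<^esub> x) (s \<otimes> t)" (is "?U = ?f")
  proof
    show "?U \<subseteq> ?f" using * by fast
    show "?f \<subseteq> ?U"
      using self.frac_self[of a s] frac_self[OF x] a by (simp add: R.self_module_simps) blast
  qed
  finally show ?thesis .
qed

lemma loc_ring_simps:
  "carrier (loc_ring R S) = {self.frac a s | a s. a \<in> carrier R \<and> s \<in> S}"
  "\<zero>\<^bsub>loc_ring R S\<^esub> = self.frac \<zero> \<one>"
  "\<one>\<^bsub>loc_ring R S\<^esub> = self.frac \<one> \<one>"
  by (simp_all add: loc_ring_def loc_module_def Let_def R.self_module_simps)

lemma loc_ring_add:
  assumes "a \<in> carrier R" "s \<in> S" "b \<in> carrier R" "t \<in> S"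
  shows "self.frac a s \<oplus>\<^bsub>loc_ring R S\<^esub> self.frac b t = self.frac (t \<otimes> a \<oplus> s \<otimes> b) (s \<otimes> t)"
  using self.loc_module_add[of a s b t] assms
  by (simp add: loc_ring_def Let_def R.self_module_simps)

lemma loc_ring_mult:
  assumes "a \<in> carrier R" "s \<in> S" "b \<in> carrier R" "t \<in> S"
  shows "self.frac a s \<otimes>\<^bsub>loc_ring R S\<^esub> self.frac b t = self.frac (a \<otimes> b) (s \<otimes> t)"
  using localization.loc_smult[OF localization_self, of a s b t] assms
  by (simp add: loc_ring_def Let_def R.self_module_simps)

end

text \<open>The product of the individual multipliers works for all \<open>j\<close>; this clears finitely many denominators at once.\<close>

lemma (in localization) common_multiplier:
  assumes "finite J" "\<And>j. j \<in> J \<Longrightarrow> \<exists>s\<in>S. Q j s"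
    and "\<And>j s t. j \<in> J \<Longrightarrow> s \<in> S \<Longrightarrow> t \<in> S \<Longrightarrow> Q j s \<Longrightarrow> Q j (t \<otimes> s)"
  shows "\<exists>s\<in>S. \<forall>j\<in>J. Q j s"
  using assms
proof (induction J rule: finite_induct)
  case empty
  then show ?case using S_one by auto
next
  case (insert j J)
  obtain s where s: "s \<in> S" "\<forall>j\<in>J. Q j s" using insert.IH insert.prems by (metis insertI2)
  obtain t where t: "t \<in> S" "Q j t" using insert.prems(1) by blast
  have "Q j (s \<otimes> t)" using insert.prems(2)[of j t s] s t by simp
  moreover have "\<forall>i\<in>J. Q i (t \<otimes> s)" using insert.prems(2) s t by simp
  moreover have "s \<otimes> t = t \<otimes> s" using s t by (simp add: S_closed R.m_comm)
  ultimately show ?case using S_mult[OF s(1) t(1)] by auto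
qed

text \<open>The coefficient \<open>r b\<close> is multiplied by the denominator \<open>t b\<close> of the basis element \<open>y b / t b\<close>, so that the image is a
combination of the numerators alone and can be formed inside \<open>M\<close>.\<close>

lemma (in localization) free_localization_hom_combination:
  fixes B :: "'x set"
  defines "L \<equiv> loc_ring R S"
  assumes \<phi>: "\<phi> \<in> mod_hom L (free_mod L B) (loc_module R S M)"
    and y: "\<And>b. b \<in> B \<Longrightarrow> y b \<in> carrier M" and t: "\<And>b. b \<in> B \<Longrightarrow> t b \<in> S"
    and yt: "\<And>b. b \<in> B \<Longrightarrow> \<phi> (unit_vec L b) = frac (y b) (t b)"
    and A: "finite A" "A \<subseteq> B" "\<And>b. b \<in> A \<Longrightarrow> r b \<in> carrier R"
  shows "(\<lambda>b. if b \<in> A then self.frac (r b \<otimes> t b) \<one> else \<zero>\<^bsub>L\<^esub>) \<in> carrier (free_mod L B)"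
    and "\<phi> (\<lambda>b. if b \<in> A then self.frac (r b \<otimes> t b) \<one> else \<zero>\<^bsub>L\<^esub>) = frac (\<Oplus>\<^bsub>M\<^esub>b\<in>A. r b \<odot>\<^bsub>M\<^esub> y b) \<one>"
proof -
  note L = loc_ring_simps[folded L_def] and Ladd = loc_ring_add[folded L_def]
    and Lmult = loc_ring_mult[folded L_def]
  have Lz: "self.frac \<zero> s = \<zero>\<^bsub>L\<^esub>" if "s \<in> S" for s
    using self.frac_zero[OF that] by (simp add: L R.self_module_simps)
  have zL: "\<zero>\<^bsub>L\<^esub> \<in> carrier L" and oL: "\<one>\<^bsub>L\<^esub> \<in> carrier L" using S_one by (auto simp: L)
  have fL: "self.frac a \<one> \<in> carrier L" if "a \<in> carrier R" for a using S_one that by (auto simp: L)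
  have mz: "self.frac a s \<otimes>\<^bsub>L\<^esub> \<zero>\<^bsub>L\<^esub> = \<zero>\<^bsub>L\<^esub>" if "a \<in> carrier R" "s \<in> S" for a s
    using that Lmult[of a s \<zero> \<one>] Lz[OF that(2)] S_one by (simp add: L(2) S_closed)
  have az: "self.frac a s \<oplus>\<^bsub>L\<^esub> \<zero>\<^bsub>L\<^esub> = self.frac a s" if "a \<in> carrier R" "s \<in> S" for a s
    using that Ladd[of a s \<zero> \<one>] S_one by (simp add: L(2) S_closed)
  have za: "\<zero>\<^bsub>L\<^esub> \<oplus>\<^bsub>L\<^esub> self.frac a s = self.frac a s" if "a \<in> carrier R" "s \<in> S" for a s
    using that Ladd[of \<zero> \<one> a s] S_one by (simp add: L(2) S_closed)
  have mem: "(\<lambda>b. if b \<in> A then self.frac (r b \<otimes> t b) \<one> else \<zero>\<^bsub>L\<^esub>) \<in> carrier (free_mod L B)"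
    if A: "finite A" "A \<subseteq> B" "\<And>b. b \<in> A \<Longrightarrow> r b \<in> carrier R" for A
  proof -
    have "r b \<otimes> t b \<in> carrier R" if "b \<in> A" for b
      using A(3)[OF that] S_closed[OF t, of b] A(2) that by auto
    then show ?thesis using A(1,2) zL fL
      by (auto simp: free_mod_def intro: finite_subset[of _ A])
  qed
  show "(\<lambda>b. if b \<in> A then self.frac (r b \<otimes> t b) \<one> else \<zero>\<^bsub>L\<^esub>) \<in> carrier (free_mod L B)"
    by (rule mem[OF A])
  show "\<phi> (\<lambda>b. if b \<in> A then self.frac (r b \<otimes> t b) \<one> else \<zero>\<^bsub>L\<^esub>) = frac (\<Oplus>\<^bsub>M\<^esub>b\<in>A. r b \<odot>\<^bsub>M\<^esub> y b) \<one>"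
    using A
  proof (induction A rule: finite_induct)
    case empty
    let ?z = "\<lambda>x::'x. \<zero>\<^bsub>L\<^esub>"
    have zc: "?z \<in> carrier (free_mod L B)" using mem[of "{}"] by simp
    have "\<phi> ?z \<in> carrier (loc_module R S M)" by (rule mod_homD(1)[OF \<phi> zc])
    then obtain x s where x: "x \<in> carrier M" "s \<in> S" "\<phi> ?z = frac x s" by (auto simp: loc_module_carrier)
    have "\<phi> ?z = \<phi> (\<zero>\<^bsub>L\<^esub> \<odot>\<^bsub>free_mod L B\<^esub> ?z)"
      using mz[of \<zero> \<one>] S_one by (simp add: free_mod_def L(2))
    also have "\<dots> = \<zero>\<^bsub>L\<^esub> \<odot>\<^bsub>loc_module R S M\<^esub> frac x s" using mod_homD(3)[OF \<phi> zL zc] x by simp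
    also have "\<dots> = frac \<zero>\<^bsub>M\<^esub> \<one>" using x S_one loc_smult[of \<zero> \<one> x s] frac_zero[OF x(2)]
      by (simp add: L(2) S_closed)
    finally show ?case by simp
  next
    case (insert b A)
    let ?v = "\<lambda>A b. if b \<in> A then self.frac (r b \<otimes> t b) \<one> else \<zero>\<^bsub>L\<^esub>"
    let ?c = "self.frac (r b \<otimes> t b) \<one>"
    let ?e = "?c \<odot>\<^bsub>free_mod L B\<^esub> unit_vec L b"
    have b: "b \<in> B" "r b \<in> carrier R" "t b \<in> S" using insert.prems t by auto
    have rt: "r b' \<otimes> t b' \<in> carrier R" if "b' \<in> insert b A" for b'
      using insert.prems(2)[OF that] S_closed[OF t, of b'] insert.prems(1) that by auto
    have ub: "unit_vec L b \<in> carrier (free_mod L B)"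
      using b zL oL by (auto simp: free_mod_def unit_vec_def)
    have one: "?c \<otimes>\<^bsub>L\<^esub> \<one>\<^bsub>L\<^esub> = ?c" using Lmult[of "r b \<otimes> t b" \<one> \<one> \<one>] S_one rt[of b] by (simp add: L(3))
    have e_eq: "?e = ?v {b}"
      using one mz[OF rt S_one, of b] by (intro ext) (auto simp: free_mod_def unit_vec_def)
    have ec: "?e \<in> carrier (free_mod L B)" unfolding e_eq using b by (intro mem) auto
    have vc: "?v A \<in> carrier (free_mod L B)" using insert.hyps(1) insert.prems by (intro mem) auto
    have "?v (insert b A) = ?e \<oplus>\<^bsub>free_mod L B\<^esub> ?v A"
      unfolding e_eq using insert.hyps(2) az[OF rt S_one] za[OF rt S_one] az[OF R.zero_closed S_one]
      by (intro ext) (auto simp: free_mod_def L(2))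
    then have "\<phi> (?v (insert b A)) = \<phi> ?e \<oplus>\<^bsub>loc_module R S M\<^esub> \<phi> (?v A)"
      using mod_homD(2)[OF \<phi> ec vc] by simp
    also have "\<phi> ?e = ?c \<odot>\<^bsub>loc_module R S M\<^esub> frac (y b) (t b)"
      using mod_homD(3)[OF \<phi> fL ub] rt[of b] yt[OF b(1)] by simp
    also have "\<dots> = frac ((r b \<otimes> t b) \<odot>\<^bsub>M\<^esub> y b) (t b)"
      using loc_smult[of "r b \<otimes> t b" \<one> "y b" "t b"] rt[of b] b y S_one by (simp add: S_closed)
    also have "(r b \<otimes> t b) \<odot>\<^bsub>M\<^esub> y b = t b \<odot>\<^bsub>M\<^esub> (r b \<odot>\<^bsub>M\<^esub> y b)"
      using b y S_closed by (simp add: smult_left_commute[of "t b"] smult_assoc1)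
    also have "frac (t b \<odot>\<^bsub>M\<^esub> (r b \<odot>\<^bsub>M\<^esub> y b)) (t b) = frac (r b \<odot>\<^bsub>M\<^esub> y b) \<one>"
      using frac_cancel[of "r b \<odot>\<^bsub>M\<^esub> y b" \<one> "t b"] b y S_one by (simp add: S_closed)
    also have "\<phi> (?v A) = frac (\<Oplus>\<^bsub>M\<^esub>b\<in>A. r b \<odot>\<^bsub>M\<^esub> y b) \<one>" using insert.IH insert.prems by simp
    finally show ?case
      using insert.hyps insert.prems y b S_one
      by (subst (asm) loc_module_add) (auto simp: subset_iff Pi_iff M.finsum_insert intro!: M.finsum_closed)
  qed
qed

text \<open>Freeness of \<open>S\<^bsup>-1\<^esup> M\<close> in terms of \<open>M\<close> itself. Since denominators are units of \<open>S\<^bsup>-1\<^esup> R\<close>, a basis can be rescaled to consist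
of images of elements \<open>y b\<close> of \<open>M\<close>. They are linearly independent and generate \<open>M\<close>, both up to factors from \<open>S\<close>.
The splitting of the resolution is built from these two properties alone.\<close>

lemma (in localization) free_localization_basis:
  assumes free: "is_free_module (loc_ring R S) (loc_module R S M)"
  obtains B :: "('c \<times> 'a) set set" and y where
    "\<And>b. b \<in> B \<Longrightarrow> y b \<in> carrier M"
    "\<And>A r. finite A \<Longrightarrow> A \<subseteq> B \<Longrightarrow> (\<And>b. b \<in> A \<Longrightarrow> r b \<in> carrier R) \<Longrightarrow>
        (\<Oplus>\<^bsub>M\<^esub>b\<in>A. r b \<odot>\<^bsub>M\<^esub> y b) = \<zero>\<^bsub>M\<^esub> \<Longrightarrow> \<forall>b\<in>A. \<exists>u\<in>S. u \<otimes> r b = \<zero>"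
    "\<And>x. x \<in> carrier M \<Longrightarrow> \<exists>A r s. finite A \<and> A \<subseteq> B \<and> (\<forall>b\<in>A. r b \<in> carrier R) \<and> s \<in> S
        \<and> s \<odot>\<^bsub>M\<^esub> x = (\<Oplus>\<^bsub>M\<^esub>b\<in>A. r b \<odot>\<^bsub>M\<^esub> y b)"
proof -
  define L where "L = loc_ring R S"
  note L = loc_ring_simps[folded L_def] and Lmult = loc_ring_mult[folded L_def]
  obtain B :: "('c \<times> 'a) set set" and \<phi> where \<phi>: "\<phi> \<in> mod_hom L (free_mod L B) (loc_module R S M)"
    and bij: "bij_betw \<phi> (carrier (free_mod L B)) (carrier (loc_module R S M))"
    using free unfolding is_free_module_def mod_isomorphic_def L_def by blast
  have "\<exists>y t. y \<in> carrier M \<and> t \<in> S \<and> \<phi> (unit_vec L b) = frac y t" if "b \<in> B" for b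
  proof -
    have "unit_vec L b \<in> carrier (free_mod L B)"
      using that S_one by (auto simp: free_mod_def unit_vec_def L(1)) (auto simp: L(2,3))
    from mod_homD(1)[OF \<phi> this] show ?thesis by (auto simp: loc_module_carrier)
  qed
  then obtain y t where y: "\<And>b. b \<in> B \<Longrightarrow> y b \<in> carrier M" and t: "\<And>b. b \<in> B \<Longrightarrow> t b \<in> S"
    and yt: "\<And>b. b \<in> B \<Longrightarrow> \<phi> (unit_vec L b) = frac (y b) (t b)" by metis
  let ?v = "\<lambda>A r b. if b \<in> A then self.frac (r b \<otimes> t b) \<one> else \<zero>\<^bsub>L\<^esub>"
  have K: "?v A r \<in> carrier (free_mod L B)" "\<phi> (?v A r) = frac (\<Oplus>\<^bsub>M\<^esub>b\<in>A. r b \<odot>\<^bsub>M\<^esub> y b) \<one>"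
    if "finite A" "A \<subseteq> B" "\<And>b. b \<in> A \<Longrightarrow> r b \<in> carrier R" for A r
    unfolding L_def using free_localization_hom_combination[OF \<phi>[unfolded L_def] y t yt[unfolded L_def] that] by simp_all
  have rt: "r \<otimes> t b \<in> carrier R" if "r \<in> carrier R" "b \<in> B" for r b
    using that t S_closed by simp
  have indep: "\<forall>b\<in>A. \<exists>u\<in>S. u \<otimes> r b = \<zero>"
    if A: "finite A" "A \<subseteq> B" "\<And>b. b \<in> A \<Longrightarrow> r b \<in> carrier R"
      and sum: "(\<Oplus>\<^bsub>M\<^esub>b\<in>A. r b \<odot>\<^bsub>M\<^esub> y b) = \<zero>\<^bsub>M\<^esub>" for A r
  proof
    fix b assume b: "b \<in> A"
    have "\<phi> (?v A r) = \<phi> (?v {} r)" using K(2)[OF A] K(2)[of "{}" r] sum by simp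
    then have "?v A r = ?v {} r"
      by (rule inj_onD[OF bij_betw_imp_inj_on[OF bij]]) (use K(1)[OF A] K(1)[of "{}" r] in auto)
    then have "?v A r b = ?v {} r b" by (rule fun_cong)
    then have "self.frac (r b \<otimes> t b) \<one> = self.frac \<zero> \<one>" using b by (simp add: L)
    then obtain u where u: "u \<in> S" "u \<otimes> (r b \<otimes> t b) = \<zero>"
      using self.frac_eq_iff[of "r b \<otimes> t b" \<one> \<zero> \<one>] S_one rt[of "r b" b] A(2,3) b
      by (auto simp: R.self_module_simps S_closed)
    have "t b \<in> S" using t A(2) b by blast
    then have "u \<otimes> t b \<in> S" "(u \<otimes> t b) \<otimes> r b = \<zero>"
      using u A(3)[OF b] by (auto simp: S_mult S_closed R.m_ac)
    then show "\<exists>u\<in>S. u \<otimes> r b = \<zero>" by blast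
  qed
  have span: "\<exists>A r s. finite A \<and> A \<subseteq> B \<and> (\<forall>b\<in>A. r b \<in> carrier R) \<and> s \<in> S
        \<and> s \<odot>\<^bsub>M\<^esub> x = (\<Oplus>\<^bsub>M\<^esub>b\<in>A. r b \<odot>\<^bsub>M\<^esub> y b)" if x: "x \<in> carrier M" for x
  proof -
    have "frac x \<one> \<in> \<phi> ` carrier (free_mod L B)"
      using bij_betw_imp_surj_on[OF bij] x S_one by (auto simp: loc_module_carrier)
    then obtain v where v: "v \<in> carrier (free_mod L B)" "\<phi> v = frac x \<one>" by auto
    define A where "A = {b. v b \<noteq> \<zero>\<^bsub>L\<^esub>}"
    have A: "finite A" "A \<subseteq> B" using v(1) by (auto simp: A_def free_mod_def)
    have vL: "v b \<in> carrier L" for b using v(1) by (simp add: free_mod_def)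
    define Q where "Q b U \<longleftrightarrow> (\<exists>r\<in>carrier R. self.frac U \<one> \<otimes>\<^bsub>L\<^esub> v b = self.frac (r \<otimes> t b) \<one>)" for b U
    have "\<exists>U\<in>S. \<forall>b\<in>A. Q b U"
    proof (rule common_multiplier[OF A(1)])
      fix b assume b: "b \<in> A"
      obtain a s where a: "a \<in> carrier R" "s \<in> S" "v b = self.frac a s" using vL[of b] by (auto simp: L)
      have tb: "t b \<in> S" using t A(2) b by blast
      have "self.frac (s \<otimes> t b) \<one> \<otimes>\<^bsub>L\<^esub> v b = self.frac (s \<otimes> (a \<otimes> t b)) (s \<otimes> \<one>)"
        using a tb Lmult[of "s \<otimes> t b" \<one> a s] S_one by (simp add: S_closed R.m_ac)
      also have "\<dots> = self.frac (a \<otimes> t b) \<one>"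
        using self.frac_cancel[of "a \<otimes> t b" \<one> s] a tb S_one by (simp add: R.self_module_simps S_closed)
      finally show "\<exists>U\<in>S. Q b U" using a(1) S_mult[OF a(2) tb] by (auto simp: Q_def)
      fix U V assume U: "U \<in> S" and V: "V \<in> S" and Q: "Q b U"
      obtain r where r: "r \<in> carrier R" "self.frac U \<one> \<otimes>\<^bsub>L\<^esub> v b = self.frac (r \<otimes> t b) \<one>"
        using Q by (auto simp: Q_def)
      have c: "U \<in> carrier R" "V \<in> carrier R" "t b \<in> carrier R" "s \<in> carrier R"
        using U V tb a by (auto simp: S_closed)
      have "self.frac (V \<otimes> U) \<one> \<otimes>\<^bsub>L\<^esub> v b = self.frac V \<one> \<otimes>\<^bsub>L\<^esub> (self.frac U \<one> \<otimes>\<^bsub>L\<^esub> v b)"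
        using a c S_one by (simp add: Lmult R.m_assoc)
      also have "\<dots> = self.frac ((V \<otimes> r) \<otimes> t b) \<one>"
        unfolding r(2) using c r(1) S_one Lmult[of V \<one> "r \<otimes> t b" \<one>] by (simp add: R.m_assoc)
      finally show "Q b (V \<otimes> U)" unfolding Q_def using c r(1) by blast
    qed
    then obtain U where U: "U \<in> S" "\<And>b. b \<in> A \<Longrightarrow> Q b U" by blast
    then obtain r where r: "\<And>b. b \<in> A \<Longrightarrow> r b \<in> carrier R"
      "\<And>b. b \<in> A \<Longrightarrow> self.frac U \<one> \<otimes>\<^bsub>L\<^esub> v b = self.frac (r b \<otimes> t b) \<one>"
      unfolding Q_def by metis
    have UR: "U \<in> carrier R" using U(1) by (rule S_closed)
    have UL: "self.frac U \<one> \<in> carrier L" using UR S_one by (auto simp: L)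
    have "self.frac U \<one> \<otimes>\<^bsub>L\<^esub> \<zero>\<^bsub>L\<^esub> = \<zero>\<^bsub>L\<^esub>"
      using Lmult[of U \<one> \<zero> \<one>] UR S_one by (simp add: L(2))
    then have "self.frac U \<one> \<odot>\<^bsub>free_mod L B\<^esub> v = ?v A r"
      using r(2) by (intro ext) (auto simp: free_mod_def A_def)
    then have "frac (\<Oplus>\<^bsub>M\<^esub>b\<in>A. r b \<odot>\<^bsub>M\<^esub> y b) \<one> = self.frac U \<one> \<odot>\<^bsub>loc_module R S M\<^esub> frac x \<one>"
      using K(2)[OF A r(1)] mod_homD(3)[OF \<phi> UL v(1)] v(2) by simp
    also have "\<dots> = frac (U \<odot>\<^bsub>M\<^esub> x) \<one>" using loc_smult[of U \<one> x \<one>] UR S_one x by simp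
    finally have eq: "frac (U \<odot>\<^bsub>M\<^esub> x) \<one> = frac (\<Oplus>\<^bsub>M\<^esub>b\<in>A. r b \<odot>\<^bsub>M\<^esub> y b) \<one>" ..
    have ry: "(\<lambda>b. r b \<odot>\<^bsub>M\<^esub> y b) \<in> A \<rightarrow> carrier M" using r(1) y A(2) by auto
    obtain w where w: "w \<in> S" "w \<odot>\<^bsub>M\<^esub> (U \<odot>\<^bsub>M\<^esub> x) = w \<odot>\<^bsub>M\<^esub> (\<Oplus>\<^bsub>M\<^esub>b\<in>A. r b \<odot>\<^bsub>M\<^esub> y b)"
      using eq frac_eq_iff[of "U \<odot>\<^bsub>M\<^esub> x" \<one> "\<Oplus>\<^bsub>M\<^esub>b\<in>A. r b \<odot>\<^bsub>M\<^esub> y b" \<one>] UR x S_one M.finsum_closed[OF ry]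
      by (auto simp: S_closed)
    have wR: "w \<in> carrier R" using w(1) by (rule S_closed)
    have "(w \<otimes> U) \<odot>\<^bsub>M\<^esub> x = w \<odot>\<^bsub>M\<^esub> (\<Oplus>\<^bsub>M\<^esub>b\<in>A. r b \<odot>\<^bsub>M\<^esub> y b)" using w(2) wR UR x by (simp add: smult_assoc1)
    also have "\<dots> = (\<Oplus>\<^bsub>M\<^esub>b\<in>A. w \<odot>\<^bsub>M\<^esub> (r b \<odot>\<^bsub>M\<^esub> y b))" by (rule finsum_smult_ldistr[OF A(1) wR ry])
    also have "\<dots> = (\<Oplus>\<^bsub>M\<^esub>b\<in>A. (w \<otimes> r b) \<odot>\<^bsub>M\<^esub> y b)"
      using A(2) r(1) y wR by (intro M.finsum_cong') (auto simp: smult_assoc1)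
    finally show ?thesis using A r(1) wR S_mult[OF w(1) U(1)]
      by (intro exI[of _ A] exI[of _ "\<lambda>b. w \<otimes> r b"] exI[of _ "w \<otimes> U"]) auto
  qed
  show ?thesis using that[of B y] y indep span by blast
qed

lemma localization_at_prime:
  assumes M: "module R M" and q: "primeideal q R"
  shows "localization R M (carrier R - q)"
proof -
  interpret module R M by fact
  interpret q: primeideal q R by fact
  show ?thesis
    by unfold_locales (use q.one_imp_carrier q.I_notcarr q.I_prime in auto)
qed

section \<open>Splitting a resolution after localization\<close>

text \<open>After localization the surjection \<open>\<epsilon>\<close> onto a free module splits, so the identity of \<open>F\<^sub>0\<close> minus the splitting composed
with \<open>\<epsilon>\<close> maps \<open>F\<^sub>0\<close> to \<open>ker \<epsilon> = im f\<close> and lifts through \<open>f\<close>. The same is done over \<open>R\<close> with denominators cleared. The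
images of the finitely many basis vectors of \<open>F\<^sub>0\<close> under \<open>s \<epsilon>\<close> are combinations of finitely many \<open>y b\<close>, which gives maps
\<open>\<alpha> : F\<^sub>0 \<rightarrow> G\<close> and \<open>\<kappa> : G \<rightarrow> M\<close> with \<open>G\<close> free and \<open>\<kappa> \<alpha> = s \<epsilon>\<close>, and \<open>\<kappa>\<close> lifts to \<open>\<zeta> : G \<rightarrow> F\<^sub>0\<close>. Independence shows
\<open>u \<alpha> f = 0\<close> for one \<open>u\<close> in \<open>S\<close>, since it suffices to test the basis vectors of \<open>F\<^sub>1\<close>. So \<open>\<rho> = u \<zeta> \<alpha>\<close> plays the role of the
splitting composed with \<open>\<epsilon>\<close>, and \<open>us - \<rho>\<close> lifts through \<open>f\<close>.\<close>

lemma localized_contraction_start: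
  fixes R :: "('a, 'b) ring_scheme" and M :: "('a, 'm, 'c) module_scheme"
    and B0 :: "'x set" and B1 :: "'y set"
  assumes loc: "localization R M S" and free: "is_free_module (loc_ring R S) (loc_module R S M)"
    and B: "finite B0" "finite B1"
    and \<epsilon>: "\<epsilon> \<in> mod_hom R (free_mod R B0) M" "\<epsilon> ` carrier (free_mod R B0) = carrier M"
    and f: "f \<in> mod_hom R (free_mod R B1) (free_mod R B0)"
      "f ` carrier (free_mod R B1) = mod_ker (free_mod R B0) M \<epsilon>"
  obtains s h where "s \<in> S" "h \<in> mod_hom R (free_mod R B0) (free_mod R B1)"
    "\<And>v. v \<in> carrier (free_mod R B1) \<Longrightarrow> f (h (f v)) = s \<odot>\<^bsub>free_mod R B0\<^esub> f v"
proof -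
  interpret localization R M S by fact
  define F0 F1 where "F0 = free_mod R B0" and "F1 = free_mod R B1"
  note \<epsilon> = \<epsilon>[folded F0_def] and f = f[folded F0_def F1_def]
  interpret F0: module R F0 unfolding F0_def by (rule R.free_mod_module)
  interpret F1: module R F1 unfolding F1_def by (rule R.free_mod_module)
  have \<epsilon>f: "\<epsilon> (f v) = \<zero>\<^bsub>M\<^esub>" if "v \<in> carrier F1" for v
    using f(2) that by (auto simp: mod_ker_def)
  obtain X :: "('m \<times> 'a) set set" and y where
    y: "\<And>b. b \<in> X \<Longrightarrow> y b \<in> carrier M" and
    indep: "\<And>A r. finite A \<Longrightarrow> A \<subseteq> X \<Longrightarrow> (\<And>b. b \<in> A \<Longrightarrow> r b \<in> carrier R) \<Longrightarrow>
        (\<Oplus>\<^bsub>M\<^esub>b\<in>A. r b \<odot>\<^bsub>M\<^esub> y b) = \<zero>\<^bsub>M\<^esub> \<Longrightarrow> \<forall>b\<in>A. \<exists>u\<in>S. u \<otimes>\<^bsub>R\<^esub> r b = \<zero>\<^bsub>R\<^esub>" and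
    span: "\<And>x. x \<in> carrier M \<Longrightarrow> \<exists>A r s. finite A \<and> A \<subseteq> X \<and> (\<forall>b\<in>A. r b \<in> carrier R) \<and> s \<in> S
        \<and> s \<odot>\<^bsub>M\<^esub> x = (\<Oplus>\<^bsub>M\<^esub>b\<in>A. r b \<odot>\<^bsub>M\<^esub> y b)"
    by (rule free_localization_basis[OF free]) blast
  have e0: "unit_vec R j \<in> carrier F0" if "j \<in> B0" for j
    unfolding F0_def using that by (rule R.unit_vec_closed)
  have e1: "unit_vec R j \<in> carrier F1" if "j \<in> B1" for j
    unfolding F1_def using that by (rule R.unit_vec_closed)
  have "\<forall>j\<in>B0. \<exists>A r s. finite A \<and> A \<subseteq> X \<and> (\<forall>b\<in>A. r b \<in> carrier R) \<and> s \<in> S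
        \<and> s \<odot>\<^bsub>M\<^esub> \<epsilon> (unit_vec R j) = (\<Oplus>\<^bsub>M\<^esub>b\<in>A. r b \<odot>\<^bsub>M\<^esub> y b)"
    using span mod_homD(1)[OF \<epsilon>(1) e0] by blast
  from bchoice[OF this] obtain A' where "\<forall>j\<in>B0. \<exists>r s. finite (A' j) \<and> A' j \<subseteq> X
        \<and> (\<forall>b\<in>A' j. r b \<in> carrier R) \<and> s \<in> S
        \<and> s \<odot>\<^bsub>M\<^esub> \<epsilon> (unit_vec R j) = (\<Oplus>\<^bsub>M\<^esub>b\<in>A' j. r b \<odot>\<^bsub>M\<^esub> y b)" ..
  from bchoice[OF this] obtain r' where A': "\<And>j. j \<in> B0 \<Longrightarrow> \<exists>s. finite (A' j) \<and> A' j \<subseteq> X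
        \<and> (\<forall>b\<in>A' j. r' j b \<in> carrier R) \<and> s \<in> S
        \<and> s \<odot>\<^bsub>M\<^esub> \<epsilon> (unit_vec R j) = (\<Oplus>\<^bsub>M\<^esub>b\<in>A' j. r' j b \<odot>\<^bsub>M\<^esub> y b)" by blast
  define A where "A = (\<Union>j\<in>B0. A' j)"
  have A: "finite A" "A \<subseteq> X" unfolding A_def using B(1) A' by blast+
  define G where "G = free_mod R A"
  interpret G: module R G unfolding G_def by (rule R.free_mod_module)
  have yA: "y b \<in> carrier M" if "b \<in> A" for b using that A(2) y by blast
  obtain \<kappa> where \<kappa>: "\<kappa> \<in> mod_hom R G M" "\<And>b. b \<in> A \<Longrightarrow> \<kappa> (unit_vec R b) = y b"
    unfolding G_def by (rule free_mod_hom_exists[of R M A y, OF module_axioms A(1) yA]) blast+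
  have \<kappa>_eq: "\<kappa> g = (\<Oplus>\<^bsub>M\<^esub>b\<in>A. g b \<odot>\<^bsub>M\<^esub> y b)" if "g \<in> carrier G" for g
  proof -
    have "\<kappa> g = (\<Oplus>\<^bsub>M\<^esub>b\<in>A. g b \<odot>\<^bsub>M\<^esub> \<kappa> (unit_vec R b))"
      using free_mod_hom_expand_finite[OF module_axioms A(1) \<kappa>(1)[unfolded G_def]] that
      by (simp add: G_def)
    also have "\<dots> = (\<Oplus>\<^bsub>M\<^esub>b\<in>A. g b \<odot>\<^bsub>M\<^esub> y b)"
      using that yA by (intro M.finsum_cong') (auto simp: \<kappa>(2) G_def R.free_mod_carrier)
    finally show ?thesis .
  qed
  have "\<exists>s\<in>S. \<forall>j\<in>B0. s \<odot>\<^bsub>M\<^esub> \<epsilon> (unit_vec R j) \<in> \<kappa> ` carrier G"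
  proof (rule common_multiplier[OF B(1)])
    fix j assume j: "j \<in> B0"
    obtain s where A'j: "finite (A' j)" "A' j \<subseteq> X" "\<And>b. b \<in> A' j \<Longrightarrow> r' j b \<in> carrier R" "s \<in> S"
        "s \<odot>\<^bsub>M\<^esub> \<epsilon> (unit_vec R j) = (\<Oplus>\<^bsub>M\<^esub>b\<in>A' j. r' j b \<odot>\<^bsub>M\<^esub> y b)"
      using A'[OF j] by blast
    define g where "g b = (if b \<in> A' j then r' j b else \<zero>\<^bsub>R\<^esub>)" for b
    have AA: "A' j \<subseteq> A" using j by (auto simp: A_def)
    have g: "g \<in> carrier G"
      unfolding G_def R.free_mod_carrier_finite[OF A(1)] using A'j AA by (auto simp: g_def)
    have "\<kappa> g = (\<Oplus>\<^bsub>M\<^esub>b\<in>A' j. g b \<odot>\<^bsub>M\<^esub> \<kappa> (unit_vec R b))"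
      using free_mod_hom_expand[OF module_axioms \<kappa>(1)[unfolded G_def] _ AA g[unfolded G_def]] A'j
      by (auto simp: g_def)
    also have "\<dots> = (\<Oplus>\<^bsub>M\<^esub>b\<in>A' j. r' j b \<odot>\<^bsub>M\<^esub> y b)"
      using A'j AA yA by (intro M.finsum_cong') (auto simp: \<kappa>(2) g_def subset_iff)
    finally show "\<exists>s\<in>S. s \<odot>\<^bsub>M\<^esub> \<epsilon> (unit_vec R j) \<in> \<kappa> ` carrier G" using A'j g by (metis imageI)
    fix s t assume s: "s \<in> S" and t: "t \<in> S" and "s \<odot>\<^bsub>M\<^esub> \<epsilon> (unit_vec R j) \<in> \<kappa> ` carrier G"
    then obtain g where g: "g \<in> carrier G" "s \<odot>\<^bsub>M\<^esub> \<epsilon> (unit_vec R j) = \<kappa> g" by auto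
    have "(t \<otimes>\<^bsub>R\<^esub> s) \<odot>\<^bsub>M\<^esub> \<epsilon> (unit_vec R j) = \<kappa> (t \<odot>\<^bsub>G\<^esub> g)"
      using s t g mod_homD(1)[OF \<epsilon>(1) e0[OF j]] mod_homD(3)[OF \<kappa>(1) S_closed[OF t] g(1)]
      by (simp add: smult_assoc1 S_closed)
    then show "(t \<otimes>\<^bsub>R\<^esub> s) \<odot>\<^bsub>M\<^esub> \<epsilon> (unit_vec R j) \<in> \<kappa> ` carrier G"
      using g(1) S_closed[OF t] by auto
  qed
  then obtain s where s: "s \<in> S" "\<And>j. j \<in> B0 \<Longrightarrow> s \<odot>\<^bsub>M\<^esub> \<epsilon> (unit_vec R j) \<in> \<kappa> ` carrier G"
    by blast
  have sR: "s \<in> carrier R" using s(1) by (rule S_closed)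
  obtain \<alpha> where \<alpha>: "\<alpha> \<in> mod_hom R F0 G" "\<And>v. v \<in> carrier F0 \<Longrightarrow> \<kappa> (\<alpha> v) = s \<odot>\<^bsub>M\<^esub> \<epsilon> v"
    unfolding F0_def
    by (rule free_mod_hom_lift[OF G.module_axioms module_axioms B(1) \<kappa>(1)
        mod_hom_smult[OF \<epsilon>(1)[unfolded F0_def] module_axioms sR] s(2)]) blast+
  have \<kappa>_im: "\<kappa> (unit_vec R b) \<in> \<epsilon> ` carrier F0" if "b \<in> A" for b
    using \<kappa>(2)[OF that] yA[OF that] \<epsilon>(2) by simp
  obtain \<zeta> where \<zeta>: "\<zeta> \<in> mod_hom R G F0" "\<And>g. g \<in> carrier G \<Longrightarrow> \<epsilon> (\<zeta> g) = \<kappa> g"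
    unfolding G_def
    by (rule free_mod_hom_lift[OF F0.module_axioms module_axioms A(1) \<epsilon>(1) \<kappa>(1)[unfolded G_def] \<kappa>_im]) blast+
  have \<alpha>f: "\<alpha> (f v) \<in> carrier G" if "v \<in> carrier F1" for v
    using mod_homD(1)[OF \<alpha>(1) mod_homD(1)[OF f(1) that]] .
  have "\<exists>u\<in>S. \<forall>j\<in>B1. \<forall>b\<in>A. u \<otimes>\<^bsub>R\<^esub> \<alpha> (f (unit_vec R j)) b = \<zero>\<^bsub>R\<^esub>"
  proof (rule common_multiplier[OF B(2)])
    fix j assume j: "j \<in> B1"
    define g where "g = \<alpha> (f (unit_vec R j))"
    have g: "g \<in> carrier G" unfolding g_def by (rule \<alpha>f[OF e1[OF j]])
    have gR: "g b \<in> carrier R" for b using g by (simp add: G_def R.free_mod_carrier)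
    have "\<kappa> g = \<zero>\<^bsub>M\<^esub>"
      unfolding g_def using \<alpha>(2)[OF mod_homD(1)[OF f(1) e1[OF j]]] \<epsilon>f[OF e1[OF j]] sR by simp
    then have "\<forall>b\<in>A. \<exists>u\<in>S. u \<otimes>\<^bsub>R\<^esub> g b = \<zero>\<^bsub>R\<^esub>"
      using indep[OF A gR] \<kappa>_eq[OF g] by simp
    then show "\<exists>u\<in>S. \<forall>b\<in>A. u \<otimes>\<^bsub>R\<^esub> \<alpha> (f (unit_vec R j)) b = \<zero>\<^bsub>R\<^esub>"
      unfolding g_def[symmetric]
      by (intro common_multiplier[OF A(1)]) (auto simp: R.m_assoc S_closed gR)
    fix u t assume "u \<in> S" "t \<in> S" "\<forall>b\<in>A. u \<otimes>\<^bsub>R\<^esub> \<alpha> (f (unit_vec R j)) b = \<zero>\<^bsub>R\<^esub>"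
    then show "\<forall>b\<in>A. (t \<otimes>\<^bsub>R\<^esub> u) \<otimes>\<^bsub>R\<^esub> \<alpha> (f (unit_vec R j)) b = \<zero>\<^bsub>R\<^esub>"
      unfolding g_def[symmetric] by (auto simp: R.m_assoc S_closed gR)
  qed
  then obtain u where u: "u \<in> S" "\<And>j b. j \<in> B1 \<Longrightarrow> b \<in> A \<Longrightarrow> u \<otimes>\<^bsub>R\<^esub> \<alpha> (f (unit_vec R j)) b = \<zero>\<^bsub>R\<^esub>"
    by blast
  have uR: "u \<in> carrier R" using u(1) by (rule S_closed)
  define \<rho> where "\<rho> v = u \<odot>\<^bsub>F0\<^esub> \<zeta> (\<alpha> v)" for v
  have \<rho>: "\<rho> \<in> mod_hom R F0 F0"
    unfolding \<rho>_def by (rule mod_hom_smult[OF mod_hom_comp[OF \<alpha>(1) \<zeta>(1)] F0.module_axioms uR])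
  have \<rho>f: "\<rho> (f v) = \<zero>\<^bsub>F0\<^esub>" if v: "v \<in> carrier F1" for v
  proof (rule free_mod_hom_zeroI[OF F0.module_axioms B(2), where h = "\<lambda>v. \<rho> (f v)"])
    show "(\<lambda>v. \<rho> (f v)) \<in> mod_hom R (free_mod R B1) F0"
      using mod_hom_comp[OF f(1) \<rho>] by (simp add: F1_def)
    show "v \<in> carrier (free_mod R B1)" using v by (simp add: F1_def)
    fix j assume j: "j \<in> B1"
    have g: "\<alpha> (f (unit_vec R j)) \<in> carrier G" by (rule \<alpha>f[OF e1[OF j]])
    have "u \<odot>\<^bsub>G\<^esub> \<alpha> (f (unit_vec R j)) = \<zero>\<^bsub>G\<^esub>"
    proof
      fix b
      show "(u \<odot>\<^bsub>G\<^esub> \<alpha> (f (unit_vec R j))) b = \<zero>\<^bsub>G\<^esub> b"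
        using u(2)[OF j, of b] g uR by (cases "b \<in> A") (auto simp: G_def R.free_mod_simps R.free_mod_carrier)
    qed
    then have "\<rho> (f (unit_vec R j)) = \<zero>\<^bsub>F0\<^esub>"
      using mod_homD(3)[OF \<zeta>(1) uR g] mod_hom_zero[OF \<zeta>(1) G.module_axioms F0.module_axioms]
      by (simp add: \<rho>_def)
    moreover have "v j \<in> carrier R" using v by (simp add: F1_def R.free_mod_carrier)
    ultimately show "v j \<odot>\<^bsub>F0\<^esub> \<rho> (f (unit_vec R j)) = \<zero>\<^bsub>F0\<^esub>" by simp
  qed
  have us: "u \<otimes>\<^bsub>R\<^esub> s \<in> carrier R" using uR sR by simp
  define \<pi> where "\<pi> v = (u \<otimes>\<^bsub>R\<^esub> s) \<odot>\<^bsub>F0\<^esub> v \<ominus>\<^bsub>F0\<^esub> \<rho> v" for v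
  have \<pi>: "\<pi> \<in> mod_hom R F0 F0"
    unfolding \<pi>_def
    by (rule mod_hom_minus[OF mod_hom_smult[OF mod_hom_id F0.module_axioms us] \<rho> F0.module_axioms])
  have "\<pi> v \<in> f ` carrier F1" if v: "v \<in> carrier F0" for v
  proof -
    have \<alpha>v: "\<alpha> v \<in> carrier G" by (rule mod_homD(1)[OF \<alpha>(1) v])
    have \<epsilon>v: "\<epsilon> v \<in> carrier M" by (rule mod_homD(1)[OF \<epsilon>(1) v])
    have "\<epsilon> (\<rho> v) = u \<odot>\<^bsub>M\<^esub> (s \<odot>\<^bsub>M\<^esub> \<epsilon> v)"
      unfolding \<rho>_def using mod_homD(3)[OF \<epsilon>(1) uR mod_homD(1)[OF \<zeta>(1) \<alpha>v]] \<zeta>(2)[OF \<alpha>v] \<alpha>(2)[OF v] by simp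
    moreover have "\<epsilon> (\<pi> v) = \<epsilon> ((u \<otimes>\<^bsub>R\<^esub> s) \<odot>\<^bsub>F0\<^esub> v) \<ominus>\<^bsub>M\<^esub> \<epsilon> (\<rho> v)"
      unfolding \<pi>_def using v us
      by (intro mod_hom_diff[OF \<epsilon>(1) F0.module_axioms module_axioms]) (auto intro: mod_homD(1)[OF \<rho>])
    moreover have "\<epsilon> ((u \<otimes>\<^bsub>R\<^esub> s) \<odot>\<^bsub>F0\<^esub> v) = u \<odot>\<^bsub>M\<^esub> (s \<odot>\<^bsub>M\<^esub> \<epsilon> v)"
      using mod_homD(3)[OF \<epsilon>(1) us v] uR sR \<epsilon>v by (simp add: smult_assoc1)
    ultimately have "\<epsilon> (\<pi> v) = \<zero>\<^bsub>M\<^esub>" using uR sR \<epsilon>v by (simp add: a_minus_def M.r_neg)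
    then show ?thesis using f(2) mod_homD(1)[OF \<pi> v] by (simp add: mod_ker_def)
  qed
  then have \<pi>_im: "\<pi> (unit_vec R j) \<in> f ` carrier F1" if "j \<in> B0" for j
    using e0[OF that] by blast
  have \<pi>': "\<pi> \<in> mod_hom R (free_mod R B0) F0" using \<pi> by (simp add: F0_def)
  obtain h where h: "h \<in> mod_hom R (free_mod R B0) F1" "\<And>v. v \<in> carrier (free_mod R B0) \<Longrightarrow> f (h v) = \<pi> v"
    by (rule free_mod_hom_lift[OF F1.module_axioms F0.module_axioms B(1) f(1) \<pi>' \<pi>_im]) blast+
  note h = h[folded F0_def]
  have "f (h (f v)) = (u \<otimes>\<^bsub>R\<^esub> s) \<odot>\<^bsub>F0\<^esub> f v" if "v \<in> carrier F1" for v
    using h(2)[OF mod_homD(1)[OF f(1) that]] \<rho>f[OF that] mod_homD(1)[OF f(1) that] us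
    by (simp add: \<pi>_def a_minus_def)
  then show ?thesis
    using that[of "u \<otimes>\<^bsub>R\<^esub> s" h] S_mult[OF u(1) s(1)] h(1) by (simp add: F0_def F1_def)
qed

text \<open>The usual construction of a contracting homotopy: \<open>s - h f\<close> maps \<open>F\<^sub>1\<close> into \<open>ker f = im g\<close> and lifts through \<open>g\<close>, and
composing with \<open>g\<close> removes the term \<open>h f\<close>.\<close>

lemma contraction_step:
  fixes R :: "('a, 'b) ring_scheme" and B :: "nat \<Rightarrow> 'x set"
  defines "F \<equiv> \<lambda>i. free_mod R (B i)"
  assumes R: "cring R" and B: "finite (B 1)" and s: "s \<in> carrier R"
    and f: "f \<in> mod_hom R (F 1) (F 0)" and g: "g \<in> mod_hom R (F 2) (F 1)"
    and exact: "g ` carrier (F 2) = mod_ker (F 1) (F 0) f"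
    and h: "h \<in> mod_hom R (F 0) (F 1)"
    and con: "\<And>v. v \<in> carrier (F 1) \<Longrightarrow> f (h (f v)) = s \<odot>\<^bsub>F 0\<^esub> f v"
  obtains h' where "h' \<in> mod_hom R (F 1) (F 2)"
    "\<And>v. v \<in> carrier (F 2) \<Longrightarrow> g (h' (g v)) = s \<odot>\<^bsub>F 1\<^esub> g v"
proof -
  interpret cring R by fact
  interpret F: module R "F i" for i unfolding F_def by (rule free_mod_module)
  define \<pi> where "\<pi> v = s \<odot>\<^bsub>F 1\<^esub> v \<ominus>\<^bsub>F 1\<^esub> h (f v)" for v
  have \<pi>: "\<pi> \<in> mod_hom R (F 1) (F 1)"
    unfolding \<pi>_def
    by (rule mod_hom_minus[OF mod_hom_smult[OF mod_hom_id F.module_axioms s] mod_hom_comp[OF f h] F.module_axioms])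
  have im: "\<pi> v \<in> g ` carrier (F 2)" if v: "v \<in> carrier (F 1)" for v
  proof -
    have fv: "f v \<in> carrier (F 0)" by (rule mod_homD(1)[OF f v])
    have "f (\<pi> v) = f (s \<odot>\<^bsub>F 1\<^esub> v) \<ominus>\<^bsub>F 0\<^esub> f (h (f v))"
      unfolding \<pi>_def using v s mod_homD(1)[OF h fv]
      by (intro mod_hom_diff[OF f F.module_axioms F.module_axioms]) auto
    also have "\<dots> = \<zero>\<^bsub>F 0\<^esub>" using con[OF v] mod_homD(3)[OF f s v] fv s by (simp add: a_minus_def F.r_neg)
    finally show ?thesis unfolding exact using mod_homD(1)[OF \<pi> v] by (simp add: mod_ker_def)
  qed
  have im': "\<pi> (unit_vec R b) \<in> g ` carrier (F 2)" if "b \<in> B 1" for b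
    using im unit_vec_closed[OF that] by (simp add: F_def)
  obtain h' where h': "h' \<in> mod_hom R (F 1) (F 2)" "\<And>v. v \<in> carrier (F 1) \<Longrightarrow> g (h' v) = \<pi> v"
    by (rule free_mod_hom_lift[of R "F 2" "F 1" "B 1" g \<pi>, OF F.module_axioms F.module_axioms B g])
      (use \<pi> im' in \<open>simp_all add: F_def that\<close>)
  have "g (h' (g v)) = s \<odot>\<^bsub>F 1\<^esub> g v" if v: "v \<in> carrier (F 2)" for v
  proof -
    have gv: "g v \<in> carrier (F 1)" "f (g v) = \<zero>\<^bsub>F 0\<^esub>"
      using exact v by (auto simp: mod_ker_def)
    then have "h (f (g v)) = \<zero>\<^bsub>F 1\<^esub>" using mod_hom_zero[OF h F.module_axioms F.module_axioms] by simp
    then show ?thesis using h'(2)[OF gv(1)] gv(1) s by (simp add: \<pi>_def a_minus_def)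
  qed
  then show ?thesis using that h'(1) by blast
qed

text \<open>On \<open>im f\<^bsub>k+1\<^esub>\<close> the endomorphism \<open>f\<^bsub>k+1\<^esub> h\<close> of \<open>F\<^sub>k\<close> is multiplication by \<open>s\<close>. So, up to the factor \<open>s\<close>, it is a projection
of \<open>F\<^sub>k\<close> onto the syzygy module, which becomes a direct summand when \<open>s\<close> is inverted.\<close>

lemma localized_contraction:
  fixes R :: "('a, 'b) ring_scheme" and \<beta> :: "nat \<Rightarrow> nat"
  defines "F \<equiv> \<lambda>i. free_mod R {..<\<beta> i}"
  assumes loc: "localization R M S" and free: "is_free_module (loc_ring R S) (loc_module R S M)"
    and res: "is_resolution R M F \<epsilon> f"
  shows "\<exists>s\<in>S. \<exists>h\<in>mod_hom R (F k) (F (k + 1)).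
    \<forall>v\<in>carrier (F (k + 1)). f (k + 1) (h (f (k + 1) v)) = s \<odot>\<^bsub>F k\<^esub> f (k + 1) v"
proof (induction k)
  note r = res[unfolded is_resolution_def]
  case 0
  have "\<epsilon> \<in> mod_hom R (free_mod R {..<\<beta> 0}) M" "\<epsilon> ` carrier (free_mod R {..<\<beta> 0}) = carrier M"
    "f 1 \<in> mod_hom R (free_mod R {..<\<beta> 1}) (free_mod R {..<\<beta> 0})"
    "f 1 ` carrier (free_mod R {..<\<beta> 1}) = mod_ker (free_mod R {..<\<beta> 0}) M \<epsilon>"
    using r by (auto simp: F_def)
  from localized_contraction_start[OF loc free finite_lessThan finite_lessThan this]
  show ?case by (metis F_def add_0)
next
  note r = res[unfolded is_resolution_def]
  case (Suc k)
  interpret localization R M S by fact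
  obtain s h where s: "s \<in> S" and h: "h \<in> mod_hom R (F k) (F (k + 1))"
    "\<And>v. v \<in> carrier (F (k + 1)) \<Longrightarrow> f (k + 1) (h (f (k + 1) v)) = s \<odot>\<^bsub>F k\<^esub> f (k + 1) v"
    using Suc.IH by blast
  have f: "f (k + 1) \<in> mod_hom R (F (k + 1)) (F k)" "f (k + 2) \<in> mod_hom R (F (k + 2)) (F (k + 1))"
    "f (k + 2) ` carrier (F (k + 2)) = mod_ker (F (k + 1)) (F k) (f (k + 1))"
  proof -
    have a: "f i \<in> mod_hom R (F i) (F (i - 1))"
      "f (i + 1) ` carrier (F (i + 1)) = mod_ker (F i) (F (i - 1)) (f i)" if "i > 0" for i
      using r that by auto
    show "f (k + 1) \<in> mod_hom R (F (k + 1)) (F k)" "f (k + 2) \<in> mod_hom R (F (k + 2)) (F (k + 1))"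
      "f (k + 2) ` carrier (F (k + 2)) = mod_ker (F (k + 1)) (F k) (f (k + 1))"
      using a(1)[of "k + 1"] a(1)[of "k + 2"] a(2)[of "k + 1"] by simp_all
  qed
  obtain h' where "h' \<in> mod_hom R (F (k + 1)) (F (k + 2))"
    "\<And>v. v \<in> carrier (F (k + 2)) \<Longrightarrow> f (k + 2) (h' (f (k + 2) v)) = s \<odot>\<^bsub>F (k + 1)\<^esub> f (k + 2) v"
    using contraction_step[of R "\<lambda>i. {..<\<beta> (k + i)}" s "f (k + 1)" "f (k + 2)" h thesis, OF R.cring_axioms _ S_closed[OF s]]
      f h by (auto simp: F_def)
  then show ?case using s by (intro bexI[of _ s] bexI[of _ h']) auto
qed

text \<open>Let \<open>P = f h\<close>, the projection up to the factor \<open>s\<close>. Not all entries of its matrix lie in \<open>q\<close>: otherwise they kill \<open>y\<close>, as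
\<open>q\<close> is the annihilator of \<open>y\<close>, and \<open>s y = P y = 0\<close> would put \<open>s\<close> into \<open>q\<close>. An entry outside \<open>q\<close> is outside
every smaller prime \<open>p\<close>. As \<open>c\<close> kills the columns of \<open>P\<close>, which lie in the image of \<open>f\<close>, the product of \<open>c\<close> with this entry is
zero, and \<open>c\<close> must be in \<open>p\<close>.\<close>

lemma annihilator_subset_smaller_prime:
  fixes R :: "('a, 'b) ring_scheme" and B0 :: "'x set" and B1 :: "'y set"
  defines "F \<equiv> free_mod R B0" and "G \<equiv> free_mod R B1"
  assumes R: "cring R" and B: "finite B0" and q: "primeideal q R"
    and f: "f \<in> mod_hom R G F" and h: "h \<in> mod_hom R F G"
    and s: "s \<in> carrier R" "s \<notin> q"
    and con: "\<And>v. v \<in> carrier G \<Longrightarrow> f (h (f v)) = s \<odot>\<^bsub>F\<^esub> f v"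
    and y: "y \<in> f ` carrier G" "q = {b \<in> carrier R. b \<odot>\<^bsub>F\<^esub> y = \<zero>\<^bsub>F\<^esub>}"
    and p: "primeideal p R" "p \<subseteq> q"
    and c: "c \<in> carrier R" "\<And>x. x \<in> f ` carrier G \<Longrightarrow> c \<odot>\<^bsub>F\<^esub> x = \<zero>\<^bsub>F\<^esub>"
  shows "c \<in> p"
proof -
  interpret cring R by fact
  interpret F: module R F unfolding F_def by (rule free_mod_module)
  interpret p: primeideal p R by fact
  define P where "P v = f (h v)" for v
  have P: "P \<in> mod_hom R F F" unfolding P_def by (rule mod_hom_comp[OF h f])
  have yF: "y \<in> carrier F" using y(1) mod_homD(1)[OF f] by auto
  have coord: "v x \<in> carrier R" if "v \<in> carrier F" for v x
    using that by (simp add: F_def free_mod_carrier)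
  have e: "P (unit_vec R b) \<in> carrier F" if "b \<in> B0" for b
    using mod_homD(1)[OF P] unit_vec_closed[OF that] by (simp add: F_def)
  have "\<exists>b\<in>B0. \<exists>j. P (unit_vec R b) j \<notin> q"
  proof (rule ccontr)
    assume neg: "\<not> ?thesis"
    have "P y = \<zero>\<^bsub>F\<^esub>"
    proof (rule free_mod_hom_zeroI[OF F.module_axioms B, of P])
      fix b assume b: "b \<in> B0"
      have "P (unit_vec R b) j \<otimes>\<^bsub>R\<^esub> y b = \<zero>\<^bsub>R\<^esub>" for j
      proof -
        have "P (unit_vec R b) j \<odot>\<^bsub>F\<^esub> y = \<zero>\<^bsub>F\<^esub>" using neg b y(2) by blast
        then show ?thesis unfolding F_def free_mod_simps by (rule fun_cong)
      qed
      then show "y b \<odot>\<^bsub>F\<^esub> P (unit_vec R b) = \<zero>\<^bsub>F\<^esub>"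
        using coord[OF yF, of b] coord[OF e[OF b]] by (simp add: F_def free_mod_simps m_comm)
    qed (use yF P in \<open>simp_all add: F_def\<close>)
    moreover have "P y = s \<odot>\<^bsub>F\<^esub> y" using y(1) con by (auto simp: P_def)
    ultimately show False using s y(2) by simp
  qed
  then obtain b j where b: "b \<in> B0" "P (unit_vec R b) j \<notin> q" by blast
  have "P (unit_vec R b) \<in> f ` carrier G"
    using mod_homD(1)[OF h] unit_vec_closed[OF b(1)] by (simp add: P_def F_def)
  then have "c \<odot>\<^bsub>F\<^esub> P (unit_vec R b) = \<zero>\<^bsub>F\<^esub>" by (rule c(2))
  then have "c \<otimes>\<^bsub>R\<^esub> P (unit_vec R b) j = \<zero>\<^bsub>R\<^esub>" unfolding F_def free_mod_simps by (rule fun_cong)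
  then have "c \<otimes>\<^bsub>R\<^esub> P (unit_vec R b) j \<in> p" by simp
  then show ?thesis using p.I_prime[OF c(1) coord[OF e[OF b(1)]]] b(2) p(2) by blast
qed

section \<open>Krull dimension of quotients\<close>

text \<open>Dimensions are compared by transporting chains of primes along a strictly monotone map \<open>g\<close> between the spectra.\<close>

lemma krull_dim_mono:
  assumes "\<And>P. primeideal P R \<Longrightarrow> primeideal (g P) T"
    and "\<And>P Q. primeideal P R \<Longrightarrow> primeideal Q R \<Longrightarrow> P \<subset> Q \<Longrightarrow> g P \<subset> g Q"
  shows "krull_dim R \<le> krull_dim T"
  unfolding krull_dim_def
proof (rule Sup_subset_mono, safe)
  fix n P assume P: "\<forall>i\<le>n. primeideal (P i) R" "\<forall>i<n. P i \<subset> P (Suc i)"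
  show "\<exists>n'. enat n = enat n' \<and>
      (\<exists>Q. (\<forall>i\<le>n'. primeideal (Q i) T) \<and> (\<forall>i<n'. Q i \<subset> Q (Suc i)))"
    using P assms by (intro exI[of _ n] conjI refl exI[of _ "\<lambda>i. g (P i)"]) auto
qed

lemma primeideal_preimage_quotient:
  assumes R: "cring R" and I: "ideal I R"
  shows "primeideal P (R Quot I) \<Longrightarrow> primeideal {r \<in> carrier R. I +>\<^bsub>R\<^esub> r \<in> P} R"
    and "primeideal P (R Quot I) \<Longrightarrow> I \<subseteq> {r \<in> carrier R. I +>\<^bsub>R\<^esub> r \<in> P}"
    and "primeideal P (R Quot I) \<Longrightarrow> primeideal Q (R Quot I) \<Longrightarrow> P \<subset> Q \<Longrightarrow>
      {r \<in> carrier R. I +>\<^bsub>R\<^esub> r \<in> P} \<subset> {r \<in> carrier R. I +>\<^bsub>R\<^esub> r \<in> Q}"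
proof -
  interpret cring R by fact
  interpret I: ideal I R by fact
  have hom: "ring_hom_ring R (R Quot I) ((+>\<^bsub>R\<^esub>) I)" by (rule I.rcos_ring_hom_ring)
  show "primeideal {r \<in> carrier R. I +>\<^bsub>R\<^esub> r \<in> P} R" if "primeideal P (R Quot I)"
    by (rule ring_hom_ring.primeideal_vimage[OF hom cring_axioms that])
  have ideal: "ideal P (R Quot I)" if "primeideal P (R Quot I)" for P
    using that by (simp add: primeideal_def)
  show "I \<subseteq> {r \<in> carrier R. I +>\<^bsub>R\<^esub> r \<in> P}" if P: "primeideal P (R Quot I)"
  proof
    fix x assume x: "x \<in> I"
    have "I +>\<^bsub>R\<^esub> x = \<zero>\<^bsub>R Quot I\<^esub>" using x I.a_rcos_const[of x] by (simp add: FactRing_def)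
    then show "x \<in> {r \<in> carrier R. I +>\<^bsub>R\<^esub> r \<in> P}"
      using I.Icarr[OF x] ideal[OF P] by (simp add: additive_subgroup.zero_closed ideal.axioms(1))
  qed
  show "{r \<in> carrier R. I +>\<^bsub>R\<^esub> r \<in> P} \<subset> {r \<in> carrier R. I +>\<^bsub>R\<^esub> r \<in> Q}"
    if P: "primeideal P (R Quot I)" and Q: "primeideal Q (R Quot I)" and PQ: "P \<subset> Q"
  proof -
    obtain X where X: "X \<in> Q" "X \<notin> P" using PQ by blast
    have "X \<in> carrier (R Quot I)"
      using ideal.Icarr[OF ideal[OF Q] X(1)] .
    then obtain r where "r \<in> carrier R" "X = I +>\<^bsub>R\<^esub> r"
      unfolding FactRing_def using A_RCOSETS_def'[of R I] by auto
    then show ?thesis using X PQ by blast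
  qed
qed

lemma primeideal_image_quotient:
  assumes R: "cring R" and I: "ideal I R" and P: "primeideal P R" "I \<subseteq> P"
  shows "primeideal ((+>\<^bsub>R\<^esub>) I ` P) (R Quot I)"
    and "a \<in> carrier R \<Longrightarrow> I +>\<^bsub>R\<^esub> a \<in> (+>\<^bsub>R\<^esub>) I ` P \<longleftrightarrow> a \<in> P"
proof -
  interpret cring R by fact
  interpret I: ideal I R by fact
  interpret P: primeideal P R by fact
  have mem: "I +>\<^bsub>R\<^esub> a \<in> (+>\<^bsub>R\<^esub>) I ` P \<longleftrightarrow> a \<in> P" if a: "a \<in> carrier R" for a
  proof
    assume "I +>\<^bsub>R\<^esub> a \<in> (+>\<^bsub>R\<^esub>) I ` P"
    then obtain p where p: "p \<in> P" "I +>\<^bsub>R\<^esub> a = I +>\<^bsub>R\<^esub> p" by auto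
    then have "a \<in> I +>\<^bsub>R\<^esub> p" using I.a_rcos_self[OF a] by simp
    then obtain x where "x \<in> I" "a = x \<oplus>\<^bsub>R\<^esub> p" by (auto simp: a_r_coset_def')
    then show "a \<in> P" using p P(2) P.a_closed by auto
  qed simp
  then show "a \<in> carrier R \<Longrightarrow> I +>\<^bsub>R\<^esub> a \<in> (+>\<^bsub>R\<^esub>) I ` P \<longleftrightarrow> a \<in> P" .
  have rep: "\<exists>r\<in>carrier R. X = I +>\<^bsub>R\<^esub> r" if "X \<in> carrier (R Quot I)" for X
    using that unfolding FactRing_def using A_RCOSETS_def'[of R I] by auto
  show "primeideal ((+>\<^bsub>R\<^esub>) I ` P) (R Quot I)"
  proof (rule primeidealI)
    show "ideal ((+>\<^bsub>R\<^esub>) I ` P) (R Quot I)"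
      by (rule ring_ideal_imp_quot_ideal[OF I P.is_ideal])
    show "cring (R Quot I)" by (rule I.quotient_is_cring[OF cring_axioms])
    have "I +>\<^bsub>R\<^esub> \<one>\<^bsub>R\<^esub> \<in> carrier (R Quot I)"
      using I.rcos_ring_hom by (rule ring_hom_closed) simp
    moreover have "I +>\<^bsub>R\<^esub> \<one>\<^bsub>R\<^esub> \<notin> (+>\<^bsub>R\<^esub>) I ` P"
      using mem[OF one_closed] P.one_imp_carrier P.I_notcarr by auto
    ultimately show "carrier (R Quot I) \<noteq> (+>\<^bsub>R\<^esub>) I ` P" by blast
    fix A B assume A: "A \<in> carrier (R Quot I)" and B: "B \<in> carrier (R Quot I)"
      and AB: "A \<otimes>\<^bsub>R Quot I\<^esub> B \<in> (+>\<^bsub>R\<^esub>) I ` P"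
    obtain a b where a: "a \<in> carrier R" "A = I +>\<^bsub>R\<^esub> a" and b: "b \<in> carrier R" "B = I +>\<^bsub>R\<^esub> b"
      using rep A B by blast
    have "A \<otimes>\<^bsub>R Quot I\<^esub> B = I +>\<^bsub>R\<^esub> (a \<otimes>\<^bsub>R\<^esub> b)"
      using ring_hom_mult[OF I.rcos_ring_hom a(1) b(1)] a b by simp
    then have "a \<otimes>\<^bsub>R\<^esub> b \<in> P" using AB mem[of "a \<otimes>\<^bsub>R\<^esub> b"] a b by simp
    then show "A \<in> (+>\<^bsub>R\<^esub>) I ` P \<or> B \<in> (+>\<^bsub>R\<^esub>) I ` P"
      using P.I_prime[OF a(1) b(1)] a b by blast
  qed
qed

lemma krull_dim_quotient_le:
  assumes "cring R" "ideal I R"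
  shows "krull_dim (R Quot I) \<le> krull_dim R"
  by (rule krull_dim_mono[where g = "\<lambda>P. {r \<in> carrier R. I +>\<^bsub>R\<^esub> r \<in> P}"])
    (use primeideal_preimage_quotient[OF assms] in auto)

text \<open>A prime of \<open>R/J\<close> is pulled back to \<open>R\<close> and pushed forward to \<open>R/I\<close>.\<close>

lemma krull_dim_quotient_antimono:
  assumes R: "cring R" and I: "ideal I R" and J: "ideal J R" and IJ: "I \<subseteq> J"
  shows "krull_dim (R Quot J) \<le> krull_dim (R Quot I)"
proof (rule krull_dim_mono[where g = "\<lambda>P. (+>\<^bsub>R\<^esub>) I ` {r \<in> carrier R. J +>\<^bsub>R\<^esub> r \<in> P}"])
  fix P assume P: "primeideal P (R Quot J)"
  let ?P = "{r \<in> carrier R. J +>\<^bsub>R\<^esub> r \<in> P}"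
  note p = primeideal_preimage_quotient[OF R J]
  show "primeideal ((+>\<^bsub>R\<^esub>) I ` ?P) (R Quot I)"
    using primeideal_image_quotient(1)[OF R I p(1)[OF P]] p(2)[OF P] IJ by blast
  fix Q assume Q: "primeideal Q (R Quot J)" and PQ: "P \<subset> Q"
  let ?Q = "{r \<in> carrier R. J +>\<^bsub>R\<^esub> r \<in> Q}"
  obtain r where r: "r \<in> ?Q" "r \<notin> ?P" using p(3)[OF P Q PQ] by blast
  have "I +>\<^bsub>R\<^esub> r \<notin> (+>\<^bsub>R\<^esub>) I ` ?P"
    using primeideal_image_quotient(2)[OF R I p(1)[OF P], of r] p(2)[OF P] IJ r by auto
  moreover have "(+>\<^bsub>R\<^esub>) I ` ?P \<subseteq> (+>\<^bsub>R\<^esub>) I ` ?Q" using PQ by blast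
  ultimately show "(+>\<^bsub>R\<^esub>) I ` ?P \<subset> (+>\<^bsub>R\<^esub>) I ` ?Q" using r(1) by blast
qed

text \<open>In finite Krull dimension an infinite strictly descending sequence of primes is impossible, since its initial segments are
chains of every length.\<close>

lemma minimal_prime_below:
  assumes dim: "krull_dim R = enat d" and q: "primeideal q R"
  obtains p where "minimal_prime R p" "p \<subseteq> q"
proof (rule ccontr)
  assume "\<not> thesis"
  then have none: "\<not> minimal_prime R p" if "p \<subseteq> q" for p
    using \<open>\<And>p. minimal_prime R p \<Longrightarrow> p \<subseteq> q \<Longrightarrow> thesis\<close>[of p] that by auto
  have step: "\<exists>p'. (primeideal p' R \<and> p' \<subseteq> q) \<and> p' \<subset> p" if p: "primeideal p R \<and> p \<subseteq> q" for p
  proof -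
    obtain p' where "primeideal p' R" "p' \<subseteq> p" "p' \<noteq> p"
      using none[of p] p unfolding minimal_prime_def by auto
    then show ?thesis using p by (intro exI[of _ p']) auto
  qed
  have "\<exists>Q. \<forall>n::nat. (primeideal (Q n) R \<and> Q n \<subseteq> q) \<and> Q (Suc n) \<subset> Q n"
    by (rule dependent_nat_choice[of "\<lambda>_ p. primeideal p R \<and> p \<subseteq> q" "\<lambda>_ p p'. p' \<subset> p"])
      (rule exI[of _ q], use q in simp, rule step)
  then obtain Q :: "nat \<Rightarrow> _" where Q: "\<And>n. primeideal (Q n) R" "\<And>n. Q (Suc n) \<subset> Q n" by blast
  have "enat (Suc d) \<le> krull_dim R"
    unfolding krull_dim_def
  proof (rule Sup_upper, rule CollectI, rule exI[of _ "Suc d"], rule conjI[OF refl],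
      rule exI[of _ "\<lambda>i. Q (Suc d - i)"], intro conjI)
    show "\<forall>i\<le>Suc d. primeideal (Q (Suc d - i)) R" using Q by blast
    show "\<forall>i<Suc d. Q (Suc d - i) \<subset> Q (Suc d - Suc i)" using Q(2) by (metis Suc_diff_Suc)
  qed
  then show False using dim by simp
qed

section \<open>Length and dimension of syzygies\<close>

theorem corollary4p5:
  fixes R :: "('a, 'b) ring_scheme" and \<mm> :: "'a set" and d :: nat
    and M :: "('a, 'm, 'c) module_scheme"
    and \<beta> :: "nat \<Rightarrow> nat" and \<epsilon> :: "(nat \<Rightarrow> 'a) \<Rightarrow> 'm"
    and f :: "nat \<Rightarrow> (nat \<Rightarrow> 'a) \<Rightarrow> (nat \<Rightarrow> 'a)"
  assumes "noetherian_ring R" and "local_ring R \<mm>"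
    and "krull_dim R = enat d" and "d > 0"
    and "\<forall>a\<in>\<mm>. \<forall>x\<in>local_cohomology_0 R \<mm>. a \<otimes>\<^bsub>R\<^esub> x = \<zero>\<^bsub>R\<^esub>"
    and "module R M" and "finitely_generated_module R M"
    and "locally_free_on_punctured_spectrum R \<mm> M"
    and "proj_dim R M = \<infinity>"
    and "minimal_free_resolution R \<mm> M \<beta> \<epsilon> f"
  shows "(\<forall>i>2. module_length R (Syz R M \<beta> \<epsilon> f i) = \<infinity>) \<and>
    (equidimensional R \<longrightarrow> (\<forall>i>2. module_dim R (Syz R M \<beta> \<epsilon> f i) = krull_dim R))"
proof -
  note R = assms(1,2)
  interpret cring R using local_ringD[OF R(2)] by blast
  have mI: "ideal \<mm> R" using local_ringD[OF R(2)] by blast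
  define F :: "nat \<Rightarrow> ('a, nat \<Rightarrow> 'a) module" where "F i = free_mod R {..<\<beta> i}" for i
  interpret F: module R "F i" for i unfolding F_def by (rule free_mod_module)
  have res: "is_resolution R M F \<epsilon> f"
    using assms(10) by (simp add: minimal_free_resolution_def F_def[abs_def])
  have sq: "\<forall>a\<in>\<mm>. a \<otimes>\<^bsub>R\<^esub> x = \<zero>\<^bsub>R\<^esub>"
    if "x \<in> carrier R" "\<forall>a\<in>\<mm>. \<forall>b\<in>\<mm>. a \<otimes>\<^bsub>R\<^esub> (b \<otimes>\<^bsub>R\<^esub> x) = \<zero>\<^bsub>R\<^esub>" for x
    using local_cohomology_0_square[OF cring_axioms mI that] assms(5) by blast
  have main: "module_length R (Syz R M \<beta> \<epsilon> f i) = \<infinity> \<and>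
      (equidimensional R \<longrightarrow> module_dim R (Syz R M \<beta> \<epsilon> f i) = krull_dim R)" if i: "i > 2" for i
  proof -
    \<comment> \<open>\<open>Syz\<^sub>i(M)\<close> is the kernel of \<open>f\<^sub>k\<close>, a submodule of \<open>F\<^sub>k\<close>\<close>
    define k where "k = i - 1"
    have k: "k \<ge> 2" "k > 0" "i - 2 = k - 1" using i by (auto simp: k_def)
    define N where "N = mod_ker (F k) (F (k - 1)) (f k)"
    define Z where "Z = Syz R M \<beta> \<epsilon> f i"
    have Z: "Z = (F k)\<lparr>carrier := N\<rparr>"
      using i k by (simp add: Z_def Syz_def N_def F_def k_def)
    have hom: "f j \<in> mod_hom R (F j) (F (j - 1))"
      and exact: "f (j + 1) ` carrier (F (j + 1)) = mod_ker (F j) (F (j - 1)) (f j)" if "j > 0" for j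
      using res that by (auto simp: is_resolution_def)
    have N_im: "f (k + 1) ` carrier (F (k + 1)) = N" using exact[OF k(2)] by (simp add: N_def)
    have "submodule N R (F k)"
      unfolding N_def by (rule mod_ker_submodule[OF F.module_axioms F.module_axioms hom[OF k(2)]])
    then have "module R Z" unfolding Z by (rule submodule.submodule_is_module) (rule F.module_axioms)
    then interpret Z: module R Z .
    have Z_simps: "carrier Z = N" "\<zero>\<^bsub>Z\<^esub> = \<zero>\<^bsub>F k\<^esub>" "\<And>a x. a \<odot>\<^bsub>Z\<^esub> x = a \<odot>\<^bsub>F k\<^esub> x"
      by (simp_all add: Z)
    obtain v a where v: "v \<in> N" and a: "a \<in> \<mm>"
      and av: "\<And>n::nat. (a [^]\<^bsub>R\<^esub> n) \<odot>\<^bsub>Z\<^esub> v \<noteq> \<zero>\<^bsub>Z\<^esub>"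
      using higher_syzygy_not_torsion[OF R sq assms(9,10) k(1)] unfolding Z_simps N_def F_def by metis
    have aR: "a \<in> carrier R" using ideal.Icarr[OF mI a] .
    have len: "module_length R Z = \<infinity>"
      using finite_length_torsion[OF R Z.module_axioms _ a, of v] v av unfolding Z_simps(1) by metis
    have "module_dim R Z = krull_dim R" if eq: "equidimensional R"
    proof -
      obtain r where r: "r \<in> carrier R"
        "primeideal {b \<in> carrier R. b \<odot>\<^bsub>Z\<^esub> (r \<odot>\<^bsub>Z\<^esub> v) = \<zero>\<^bsub>Z\<^esub>} R" "a \<odot>\<^bsub>Z\<^esub> (r \<odot>\<^bsub>Z\<^esub> v) \<noteq> \<zero>\<^bsub>Z\<^esub>"
        using Z.exists_prime_annihilator_avoiding[OF R(1) _ aR av] v by (auto simp: Z_simps(1))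
      define y where "y = r \<odot>\<^bsub>Z\<^esub> v"
      define q where "q = {b \<in> carrier R. b \<odot>\<^bsub>Z\<^esub> y = \<zero>\<^bsub>Z\<^esub>}"
      have q: "primeideal q R" using r(2) by (simp add: q_def y_def)
      have yN: "y \<in> N" using Z.smult_closed[OF r(1), of v] v by (simp add: y_def Z_simps(1))
      have "q \<noteq> \<mm>" using a r(3) by (auto simp: q_def y_def)
      then have free: "is_free_module (loc_ring R (carrier R - q)) (loc_module R (carrier R - q) M)"
        using assms(8) q by (simp add: locally_free_on_punctured_spectrum_def)
      obtain s h where s: "s \<in> carrier R - q" and h: "h \<in> mod_hom R (F k) (F (k + 1))"
        and con: "\<And>v. v \<in> carrier (F (k + 1)) \<Longrightarrow> f (k + 1) (h (f (k + 1) v)) = s \<odot>\<^bsub>F k\<^esub> f (k + 1) v"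
        using localized_contraction[OF localization_at_prime[OF assms(6) q] free
            res[unfolded F_def[abs_def]], of k]
        unfolding F_def by blast
      obtain p where p: "minimal_prime R p" "p \<subseteq> q" using minimal_prime_below[OF assms(3) q] by blast
      have pp: "primeideal p R" "ideal p R" using p(1) by (auto simp: minimal_prime_def primeideal_def)
      have fk: "f (k + 1) \<in> mod_hom R (F (k + 1)) (F k)" using hom[of "k + 1"] by simp
      have "annihilator R Z \<subseteq> p"
      proof
        fix c assume "c \<in> annihilator R Z"
        then have c: "c \<in> carrier R" "\<And>x. x \<in> N \<Longrightarrow> c \<odot>\<^bsub>F k\<^esub> x = \<zero>\<^bsub>F k\<^esub>"
          by (auto simp: annihilator_def Z_simps)
        show "c \<in> p"
          by (rule annihilator_subset_smaller_prime[of R "{..<\<beta> k}" q "f (k + 1)" "{..<\<beta> (k + 1)}" h s y p c,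
                folded F_def])
            (use cring_axioms q fk h s con yN pp p(2) c N_im in \<open>auto simp: q_def Z_simps\<close>)
      qed
      then have "krull_dim (R Quot p) \<le> module_dim R Z"
        unfolding module_dim_def
        by (rule krull_dim_quotient_antimono[OF cring_axioms Z.annihilator_is_ideal pp(2)])
      moreover have "krull_dim (R Quot p) = krull_dim R"
        using eq p(1) by (simp add: equidimensional_def)
      moreover have "module_dim R Z \<le> krull_dim R"
        unfolding module_dim_def by (rule krull_dim_quotient_le[OF cring_axioms Z.annihilator_is_ideal])
      ultimately show ?thesis by (metis antisym)
    qed
    then show ?thesis using len by (simp add: Z_def)
  qed
  then show ?thesis by blast
qed

end
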